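(* Let $G$ be a graph with $n$ vertices and chromatic polynomial $P_G$, and suppose $G$ is chromatically equivalent to (i.e. has the same chromatic polynomial as) a graph which contains a vertex of degree $n-1$. Define $h'_0,\dots,h'_{n-2}$ by $$h'_0+h'_1t+\cdots+h'_{n-2}t^{n-2}=(1-t)^{n-1}\sum_{j=0}^\infty\frac{(j+1)^n-P_G(j+1)}{j+1}\,t^j.$$ Then (1) $h'_0\le h'_1\le\cdots\le h'_{\lfloor (n-2)/2\rfloor}$; (2) for $i\le (n-2)/2$, $h'_i\le h'_{n-2-i}$; (3) $(h'_0,\,h'_1-h'_0,\,\dots,\,h'_{\lceil (n-2)/2\rceil}-h'_{\lceil (n-2)/2\rceil-1})$ is an M-vector.
   Context: A sequence of nonnegative integers $(m_0,\dots,m_d)$ is an M-vector if it is the Hilbert function of a homogeneous quotient of a polynomial ring (standard graded), equivalently the degree sequence of an order ideal of monomials; by Macaulay's theorem this holds iff $m_0=1$ and $m_{i+1}\le m_i^{\langle i\rangle}$ for $1\le i\le d-1$, where writing $m_i=\binom{a_i}{i}+\cdots+\binom{a_j}{j}$ with $a_i>\cdots>a_j\ge j\ge1$, one sets $m_i^{\langle i\rangle}=\binom{a_i+1}{i+1}+\cdots+\binom{a_j+1}{j+1}$. *)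

theory Defs
  imports
    "Graph_Theory.Pair_Digraph"
    "HOL-Library.FuncSet"
    "HOL-Library.Poly_Mapping"
    "HOL-Computational_Algebra.Polynomial"
    "HOL-Computational_Algebra.Formal_Power_Series"
begin

section \<open>Chromatic polynomials\<close>

text \<open>
  A finite simple graph is a \<^const>\<open>pair_graph\<close>: each undirected edge is represented by its
  two orientations, so the degree of a vertex is its \<^const>\<open>out_degree\<close>.
\<close>

definition proper_colourings :: "'a pair_pre_digraph \<Rightarrow> nat \<Rightarrow> ('a \<Rightarrow> nat) set" where
  "proper_colourings G k =
     {c \<in> pverts G \<rightarrow>\<^sub>E {..<k}. \<forall>(u, v) \<in> parcs G. c u \<noteq> c v}"

definition chromatic_polynomial :: "'a pair_pre_digraph \<Rightarrow> int poly" where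
  "chromatic_polynomial G = (THE p. \<forall>k. poly p (int k) = int (card (proper_colourings G k)))"

lemma colourings_polynomial_exists:
  assumes "finite V" "finite E" "E \<subseteq> V \<times> V"
  shows "\<exists>p :: int poly. \<forall>k. poly p (int k) =
           int (card {c \<in> V \<rightarrow>\<^sub>E {..<k}. \<forall>(u, v) \<in> E. c u \<noteq> c v})"
  using assms
proof (induction "card E" arbitrary: V E rule: less_induct)
  case less
  show ?case
  proof (cases "E = {}")
    case True
    have "poly (monom 1 (card V)) (int k) = int (card (V \<rightarrow>\<^sub>E {..<k}))" for k
      using less.prems by (simp add: card_PiE poly_monom)
    then show ?thesis using True by auto
  next
    case False
    then obtain u v where uv: "(u, v) \<in> E" by auto
    define F where "F = E - {(u, v)}"
    have F: "E = insert (u, v) F" "(u, v) \<notin> F" "finite F" "F \<subseteq> V \<times> V"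
      using uv less.prems by (auto simp: F_def)
    have cardF: "card F < card E"
      unfolding F_def using less.prems(2) uv by (rule card_Diff1_less)
    have uV: "u \<in> V" "v \<in> V" using uv less.prems by auto
    show ?thesis
    proof (cases "u = v")
      case True
      have "{c \<in> V \<rightarrow>\<^sub>E {..<k}. \<forall>(u, v) \<in> E. c u \<noteq> c v} = {}" for k :: nat
        using uv True by auto
      then show ?thesis by (intro exI[of _ 0]) (simp only: card.empty of_nat_0 poly_0 simp_thms)
    next
      case False
      define r where "r = (\<lambda>x. if x = v then u else x)"
      define W where "W = V - {v}"
      define F' where "F' = map_prod r r ` F"
      define A where "A k = {c \<in> V \<rightarrow>\<^sub>E {..<k::nat}. \<forall>(x, y) \<in> F. c x \<noteq> c y}" for k
      define B where "B k = {c \<in> A k. c u = c v}" for k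
      define C where "C k = {c \<in> W \<rightarrow>\<^sub>E {..<k::nat}. \<forall>(x, y) \<in> F'. c x \<noteq> c y}" for k
      have rW: "r x \<in> W" if "x \<in> V" for x
        using that uV False by (auto simp: r_def W_def)
      have F': "finite F'" "F' \<subseteq> W \<times> W" "card F' < card E"
        using F cardF rW card_image_le[of F "map_prod r r"] by (auto simp: F'_def)
      obtain p :: "int poly" where p: "poly p (int k) = int (card (A k))" for k
        using less.hyps[OF cardF less.prems(1) F(3,4)] unfolding A_def by auto
      obtain q :: "int poly" where q: "poly q (int k) = int (card (C k))" for k
        using less.hyps[OF F'(3) _ F'(1,2)] less.prems(1) unfolding C_def W_def by auto
      have BC: "card (B k) = card (C k)" for k
      proof (rule bij_betw_same_card[of "\<lambda>c. restrict c W"],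
             rule bij_betw_byWitness[of _ "\<lambda>c. restrict (\<lambda>x. c (r x)) V"])
        show "\<forall>c\<in>B k. restrict (\<lambda>x. restrict c W (r x)) V = c"
        proof
          fix c assume c: "c \<in> B k"
          show "restrict (\<lambda>x. restrict c W (r x)) V = c"
          proof
            fix x
            show "restrict (\<lambda>x. restrict c W (r x)) V x = c x"
              using c rW[of x] by (cases "x \<in> V")
                (auto simp: B_def A_def r_def PiE_def extensional_def split: if_splits)
          qed
        qed
        show "\<forall>c\<in>C k. restrict (restrict (\<lambda>x. c (r x)) V) W = c"
        proof
          fix c assume c: "c \<in> C k"
          show "restrict (restrict (\<lambda>x. c (r x)) V) W = c"
          proof
            fix x
            show "restrict (restrict (\<lambda>x. c (r x)) V) W x = c x"
              using c by (cases "x \<in> W")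
                (auto simp: C_def W_def r_def PiE_def extensional_def)
          qed
        qed
        show "(\<lambda>c. restrict c W) ` B k \<subseteq> C k"
        proof (clarify)
          fix c assume c: "c \<in> B k"
          have cr: "c (r x) = c x" for x using c by (auto simp: B_def r_def)
          have "restrict c W (r x) \<noteq> restrict c W (r y)" if "(x, y) \<in> F" for x y
            using that c rW[of x] rW[of y] F(4) cr by (auto simp: B_def A_def)
          moreover have "restrict c W \<in> W \<rightarrow>\<^sub>E {..<k}"
            using c by (auto simp: B_def A_def W_def)
          ultimately show "restrict c W \<in> C k" unfolding C_def F'_def by (auto simp del: restrict_apply)
        qed
        show "(\<lambda>c. restrict (\<lambda>x. c (r x)) V) ` C k \<subseteq> B k"
        proof (clarify)
          fix c assume c: "c \<in> C k"
          have "c (r x) \<noteq> c (r y)" if "(x, y) \<in> F" for x y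
          proof -
            have "(r x, r y) \<in> F'" unfolding F'_def using that by (rule map_prod_imageI)
            then show ?thesis using c by (auto simp: C_def)
          qed
          then have "restrict (\<lambda>x. c (r x)) V x \<noteq> restrict (\<lambda>x. c (r x)) V y"
            if "(x, y) \<in> F" for x y
            using that F(4) by auto
          moreover have "restrict (\<lambda>x. c (r x)) V \<in> V \<rightarrow>\<^sub>E {..<k}"
            using c rW by (auto simp: C_def)
          moreover have "restrict (\<lambda>x. c (r x)) V u = restrict (\<lambda>x. c (r x)) V v"
            using uV by (simp add: r_def)
          ultimately show "restrict (\<lambda>x. c (r x)) V \<in> B k"
            unfolding B_def A_def by (auto simp del: restrict_apply)
        qed
      qed
      have finA: "finite (A k)" for k
        unfolding A_def using less.prems(1) by (auto intro!: finite_PiE)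
      have "{c \<in> V \<rightarrow>\<^sub>E {..<k}. \<forall>(u, v) \<in> E. c u \<noteq> c v} = A k - B k" for k
        unfolding A_def B_def F(1) by auto
      then have "int (card {c \<in> V \<rightarrow>\<^sub>E {..<k}. \<forall>(u, v) \<in> E. c u \<noteq> c v})
                 = int (card (A k)) - int (card (B k))" for k
        using card_Diff_subset[of "B k" "A k"] card_mono[OF finA, of "B k" k]
          finite_subset[OF _ finA, of "B k" k] by (auto simp: B_def)
      then have "poly (p - q) (int k) =
          int (card {c \<in> V \<rightarrow>\<^sub>E {..<k}. \<forall>(u, v) \<in> E. c u \<noteq> c v})" for k
        using p q BC by simp
      then show ?thesis by blast
    qed
  qed
qed

lemma poly_int_eqI:
  fixes p q :: "int poly"
  assumes "\<And>k. poly p (int k) = poly q (int k)"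
  shows "p = q"
proof (rule ccontr)
  assume "p \<noteq> q"
  then have "finite {x. poly (p - q) x = 0}" by (intro poly_roots_finite) simp
  moreover have "range int \<subseteq> {x. poly (p - q) x = 0}" using assms by auto
  ultimately have "finite (range int)" by (rule rev_finite_subset)
  then show False by (simp add: finite_image_iff)
qed

lemma poly_chromatic_polynomial:
  assumes "pair_graph G"
  shows "poly (chromatic_polynomial G) (int k) = int (card (proper_colourings G k))"
proof -
  interpret pair_graph G by fact
  have "\<exists>p :: int poly. \<forall>k. poly p (int k) = int (card (proper_colourings G k))"
    unfolding proper_colourings_def
    using arc_fst_in_verts arc_snd_in_verts
    by (intro colourings_polynomial_exists[OF pair_finite_verts pair_finite_arcs]) fastforce
  then have "\<exists>!p :: int poly. \<forall>k. poly p (int k) = int (card (proper_colourings G k))"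
    by (auto intro: poly_int_eqI)
  from theI'[OF this] show ?thesis by (simp add: chromatic_polynomial_def)
qed


section \<open>M-vectors\<close>

text \<open>
  The polynomial ring in the variables \<open>x\<^sub>0, \<dots>, x\<^bsub>r-1\<^esub>\<close>: monomials are exponent vectors, and
  a polynomial maps monomials to coefficients.  The grading is the standard one.
\<close>

type_synonym 'k mpoly = "(nat \<Rightarrow>\<^sub>0 nat) \<Rightarrow>\<^sub>0 'k"

definition mpoly_ring :: "nat \<Rightarrow> 'k::field mpoly set" where
  "mpoly_ring r = {p. \<forall>m \<in> Poly_Mapping.keys p. Poly_Mapping.keys m \<subseteq> {..<r}}"

definition mon_degree :: "(nat \<Rightarrow>\<^sub>0 nat) \<Rightarrow> nat" where
  "mon_degree m = (\<Sum>x \<in> Poly_Mapping.keys m. Poly_Mapping.lookup m x)"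

definition graded_piece :: "nat \<Rightarrow> nat \<Rightarrow> 'k::field mpoly set" where
  "graded_piece r i = {p \<in> mpoly_ring r. \<forall>m \<in> Poly_Mapping.keys p. mon_degree m = i}"

definition hom_component :: "nat \<Rightarrow> 'k::field mpoly \<Rightarrow> 'k mpoly" where
  "hom_component i p = (\<Sum>m \<in> {m \<in> Poly_Mapping.keys p. mon_degree m = i}. Poly_Mapping.single m (Poly_Mapping.lookup p m))"

definition homogeneous_ideal :: "nat \<Rightarrow> 'k::field mpoly set \<Rightarrow> bool" where
  "homogeneous_ideal r I \<longleftrightarrow>
     I \<subseteq> mpoly_ring r \<and> 0 \<in> I \<and>
     (\<forall>f \<in> I. \<forall>g \<in> I. f + g \<in> I) \<and>
     (\<forall>f \<in> mpoly_ring r. \<forall>g \<in> I. f * g \<in> I) \<and>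
     (\<forall>f \<in> I. \<forall>i. hom_component i f \<in> I)"

text \<open>
  The degree \<open>i\<close> part of the quotient by \<open>I\<close> has dimension \<open>d\<close>: there are \<open>d\<close> forms of degree
  \<open>i\<close> whose residue classes modulo \<open>I\<close> are linearly independent and span.  The scalar \<open>a\<close> acts
  as multiplication by the constant polynomial \<open>single 0 a\<close>.
\<close>

definition quotient_piece_dim :: "nat \<Rightarrow> 'k::field mpoly set \<Rightarrow> nat \<Rightarrow> nat \<Rightarrow> bool" where
  "quotient_piece_dim r I i d \<longleftrightarrow>
     (\<exists>B. finite B \<and> card B = d \<and> B \<subseteq> graded_piece r i \<and>
       (\<forall>a. (\<Sum>b \<in> B. Poly_Mapping.single 0 (a b) * b) \<in> I \<longrightarrow> (\<forall>b \<in> B. a b = 0)) \<and>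
       (\<forall>f \<in> graded_piece r i. \<exists>a. f - (\<Sum>b \<in> B. Poly_Mapping.single 0 (a b) * b) \<in> I))"

definition is_hilbert_function :: "nat \<Rightarrow> 'k::field mpoly set \<Rightarrow> (nat \<Rightarrow> nat) \<Rightarrow> bool" where
  "is_hilbert_function r I H \<longleftrightarrow> (\<forall>i. quotient_piece_dim r I i (H i))"

text \<open>
  The finite sequence \<open>m 0, \<dots>, m d\<close>, continued by zeros, is the Hilbert function of a nonzero
  homogeneous quotient of a polynomial ring over \<open>'k\<close>.  The quotient has to be nonzero, as
  M-vectors start with 1.  Entries are rational numbers because they will be differences of
  coefficients of a rational power series.
\<close>

definition M_vector :: "'k::field itself \<Rightarrow> nat \<Rightarrow> (nat \<Rightarrow> rat) \<Rightarrow> bool" where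
  "M_vector _ d m \<longleftrightarrow>
     (\<exists>r (I :: 'k mpoly set) H.
        homogeneous_ideal r I \<and> 1 \<notin> I \<and> is_hilbert_function r I H \<and>
        (\<forall>i \<le> d. m i = of_nat (H i)) \<and> (\<forall>i > d. H i = 0))"

end

theory Submission
  imports Defs
begin

text \<open>
  Let \<open>m = n - 1\<close>. The graph with a vertex of degree \<open>n - 1\<close> is a cone over a graph \<open>K\<close> on \<open>m\<close>
  vertices, so \<open>h'(t)\<close> is \<open>(1 - t)^m\<close> times the generating function of \<open>(j + 1)^m - P\<^sub>K(j)\<close>. The
  part \<open>(j + 1)^m - j^m\<close> contributes the Eulerian polynomial \<open>A\<^sub>m(t)\<close>. The part \<open>j^m - P\<^sub>K(j)\<close>
  counts improper colourings; sorting them by their first monochromatic edge gives a sum \<open>C(t)\<close>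
  of numerators \<open>(1 - t)^m \<Sum>\<^sub>j P\<^sub>L(j) t^j\<close> of graphs \<open>L\<close> on \<open>m - 1\<close> vertices.

  Splitting proper colourings by the induced acyclic orientation, and the strict maps of an
  acyclic digraph by the value at a sink, shows inductively that the numerator of a graph on
  \<open>N > 0\<close> vertices is a nonnegative combination of polynomials \<open>t^p (1 + t)^q\<close> with
  \<open>2 p + q \<ge> N + 1\<close>. Such a polynomial is symmetric and unimodal with centre \<open>p + q / 2\<close>, so the
  coefficients of \<open>C\<close> satisfy (1) and (2), as do those of \<open>A\<^sub>m\<close>.

  Moreover \<open>(1 - t) h'(t)\<close> is \<open>A\<^sub>m(t)\<close> minus the numerator of \<open>K\<close>, so for \<open>i \<le> m / 2\<close> its
  coefficients lie between \<open>A(m, i) - A(m, i - 1)\<close> and \<open>A(m, i)\<close>. Eulerian numbers grow so slowly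
  in \<open>i\<close> that any integer sequence between these bounds satisfies Macaulay's condition, with room
  to spare: for every \<open>i < m / 2\<close> some number \<open>v\<close> of variables has at most
  \<open>A(m, i) - A(m, i - 1)\<close> monomials of degree \<open>i\<close> and at least \<open>A(m, i + 1)\<close> monomials of degree
  \<open>i + 1\<close>.
\<close>

unbundle fps_syntax

section \<open>Monomials and M-vectors\<close>

definition monomials :: "nat \<Rightarrow> nat \<Rightarrow> (nat \<Rightarrow>\<^sub>0 nat) set" where
  "monomials v i = {t. Poly_Mapping.keys t \<subseteq> {..<v} \<and> mon_degree t = i}"

lemma mon_degree_eq_sum:
  assumes "finite S" "Poly_Mapping.keys t \<subseteq> S"
  shows "mon_degree t = (\<Sum>x\<in>S. Poly_Mapping.lookup t x)"
  unfolding mon_degree_def using assms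
  by (intro sum.mono_neutral_left) (auto simp: in_keys_iff)

lemma mon_degree_add: "mon_degree (s + t) = mon_degree s + mon_degree t"
proof -
  let ?S = "Poly_Mapping.keys s \<union> Poly_Mapping.keys t"
  have "mon_degree (s + t) = (\<Sum>x\<in>?S. Poly_Mapping.lookup (s + t) x)"
    using keys_add[of s t] by (intro mon_degree_eq_sum) auto
  also have "\<dots> = mon_degree s + mon_degree t"
    by (simp add: lookup_add sum.distrib mon_degree_eq_sum[of ?S s] mon_degree_eq_sum[of ?S t])
  finally show ?thesis .
qed

lemma mon_degree_single [simp]: "mon_degree (Poly_Mapping.single x k) = k"
  by (simp add: mon_degree_def)

lemma mon_degree_eq_0_iff [simp]: "mon_degree t = 0 \<longleftrightarrow> t = 0"
  by (auto simp: mon_degree_def in_keys_iff intro!: poly_mapping_eqI)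

lemma keys_add_nat:
  "Poly_Mapping.keys (s + t :: 'a \<Rightarrow>\<^sub>0 nat) = Poly_Mapping.keys s \<union> Poly_Mapping.keys t"
  by (auto simp: in_keys_iff lookup_add)

lemma monomials_degree_0 [simp]: "monomials v 0 = {0}"
  by (auto simp: monomials_def)

lemma monomials_bij_lists:
  "bij_betw (\<lambda>t. map (Poly_Mapping.lookup t) [0..<v]) (monomials v i)
     {l. length l = v \<and> sum_list l = i}"
proof (rule bij_betw_byWitness[of _ Poly_Mapping.nth])
  have degree: "mon_degree t = sum_list (map (Poly_Mapping.lookup t) [0..<v])"
    if "Poly_Mapping.keys t \<subseteq> {..<v}" for t
    using mon_degree_eq_sum[OF _ that]
    by (simp add: interv_sum_list_conv_sum_set_nat atLeast0LessThan)
  have list_nth: "map (Poly_Mapping.lookup (Poly_Mapping.nth l)) [0..<length l] = l"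
    for l :: "nat list"
    by (auto intro!: nth_equalityI simp: nth_default_def)
  show "(\<lambda>t. map (Poly_Mapping.lookup t) [0..<v]) ` monomials v i
      \<subseteq> {l. length l = v \<and> sum_list l = i}"
    using degree by (auto simp: monomials_def)
  show "\<forall>t\<in>monomials v i. Poly_Mapping.nth (map (Poly_Mapping.lookup t) [0..<v]) = t"
    by (auto intro!: poly_mapping_eqI simp: monomials_def nth_default_def in_keys_iff subset_iff)
  show "\<forall>l\<in>{l. length l = v \<and> sum_list l = i}.
      map (Poly_Mapping.lookup (Poly_Mapping.nth l)) [0..<v] = l"
    using list_nth by blast
  show "Poly_Mapping.nth ` {l. length l = v \<and> sum_list l = i} \<subseteq> monomials v i"
  proof clarify
    fix l :: "nat list" assume "v = length l"
    have "Poly_Mapping.keys (Poly_Mapping.nth l) \<subseteq> {..<length l}"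
      by (auto simp: in_set_enumerate_eq)
    then show "Poly_Mapping.nth l \<in> monomials (length l) (sum_list l)"
      using degree[of "Poly_Mapping.nth l"] list_nth[of l] \<open>v = length l\<close>
      by (simp add: monomials_def)
  qed
qed

lemma card_monomials: "card (monomials v i) = (i + v - 1) choose i"
  using bij_betw_same_card[OF monomials_bij_lists] card_length_sum_list by simp

lemma finite_monomials: "finite (monomials v i)"
proof -
  have "{l :: nat list. length l = v \<and> sum_list l = i} \<subseteq> {l. set l \<subseteq> {..i} \<and> length l = v}"
    by (auto intro: member_le_sum_list)
  then have "finite {l :: nat list. length l = v \<and> sum_list l = i}"
    using finite_lists_length_eq[of "{..i}" v] by (auto dest: finite_subset)
  then show ?thesis using bij_betw_finite[OF monomials_bij_lists] by blast
qed

lemma monomials_mono: "v \<le> w \<Longrightarrow> monomials v i \<subseteq> monomials w i"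
  by (auto simp: monomials_def)

lemma monomials_subset_if_card_le:
  assumes "card (monomials v i) \<le> card (monomials w i)"
  shows "monomials v i \<subseteq> monomials w i"
proof (cases "v \<le> w")
  case False
  then have "monomials w i \<subseteq> monomials v i" by (intro monomials_mono) simp
  then show ?thesis using card_seteq[OF finite_monomials _ assms] by simp
qed (rule monomials_mono)

definition order_ideal :: "('a \<Rightarrow>\<^sub>0 nat) set \<Rightarrow> bool" where
  "order_ideal M \<longleftrightarrow> 0 \<in> M \<and> (\<forall>s u. s + u \<in> M \<longrightarrow> s \<in> M)"

lemma order_idealD: "order_ideal M \<Longrightarrow> s + u \<in> M \<Longrightarrow> s \<in> M"
  by (auto simp: order_ideal_def)

lemma order_idealI_single:
  fixes M :: "(nat \<Rightarrow>\<^sub>0 nat) set"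
  assumes "0 \<in> M" and remove: "\<And>s x. s + Poly_Mapping.single x 1 \<in> M \<Longrightarrow> s \<in> M"
  shows "order_ideal M"
proof -
  have "s \<in> M" if "s + u \<in> M" for s u
    using that
  proof (induction "mon_degree u" arbitrary: u)
    case (Suc n)
    then have "Poly_Mapping.keys u \<noteq> {}" by (auto simp: mon_degree_def)
    then obtain x where "x \<in> Poly_Mapping.keys u" by blast
    moreover define w where "w = u - Poly_Mapping.single x 1"
    ultimately have u_eq: "u = w + Poly_Mapping.single x 1"
      by (intro poly_mapping_eqI)
        (auto simp: w_def lookup_add lookup_minus lookup_single when_def in_keys_iff)
    have "s + w \<in> M"
      using Suc.prems unfolding u_eq add.assoc[symmetric] by (rule remove)
    moreover have "n = mon_degree w" using Suc.hyps(2) by (simp add: u_eq mon_degree_add)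
    ultimately show ?case using Suc.hyps(1) by blast
  qed simp
  then show ?thesis using \<open>0 \<in> M\<close> by (simp add: order_ideal_def)
qed

definition complementary_ideal :: "nat \<Rightarrow> (nat \<Rightarrow>\<^sub>0 nat) set \<Rightarrow> 'k::field mpoly set" where
  "complementary_ideal r M = {p \<in> mpoly_ring r. Poly_Mapping.keys p \<inter> M = {}}"

lemma homogeneous_complementary_ideal:
  assumes "order_ideal M"
  shows "homogeneous_ideal r (complementary_ideal r M :: 'k::field mpoly set)"
  unfolding homogeneous_ideal_def
proof (intro conjI ballI allI)
  let ?I = "complementary_ideal r M :: 'k mpoly set"
  show "?I \<subseteq> mpoly_ring r" "0 \<in> ?I"
    by (auto simp: complementary_ideal_def mpoly_ring_def)
  show "f + g \<in> ?I" if "f \<in> ?I" "g \<in> ?I" for f g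
    using that keys_add[of f g] by (fastforce simp: complementary_ideal_def mpoly_ring_def)
  show "f * g \<in> ?I" if "f \<in> mpoly_ring r" "g \<in> ?I" for f g
  proof -
    have "Poly_Mapping.keys t \<subseteq> {..<r} \<and> t \<notin> M" if "t \<in> Poly_Mapping.keys (f * g)" for t
    proof -
      obtain a b where factors: "t = a + b" "a \<in> Poly_Mapping.keys f" "b \<in> Poly_Mapping.keys g"
        using keys_mult[of f g] \<open>t \<in> Poly_Mapping.keys (f * g)\<close> by auto
      then have "b \<notin> M" using \<open>g \<in> ?I\<close> by (auto simp: complementary_ideal_def)
      then have "t \<notin> M" using order_idealD[OF assms, of b a] factors by (auto simp: add.commute)
      then show ?thesis
        using factors \<open>f \<in> mpoly_ring r\<close> \<open>g \<in> ?I\<close>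
        by (auto simp: keys_add_nat mpoly_ring_def complementary_ideal_def)
    qed
    then show ?thesis by (auto simp: complementary_ideal_def mpoly_ring_def)
  qed
  show "hom_component i f \<in> ?I" if "f \<in> ?I" for f i
  proof -
    have "Poly_Mapping.keys (hom_component i f) \<subseteq> Poly_Mapping.keys f"
      unfolding hom_component_def by (rule order_trans[OF keys_sum]) (auto split: if_splits)
    then show ?thesis using that by (auto simp: complementary_ideal_def mpoly_ring_def)
  qed
qed

lemma lookup_sum_single:
  "finite N \<Longrightarrow>
    Poly_Mapping.lookup (\<Sum>t\<in>N. Poly_Mapping.single t (c t)) s = (if s \<in> N then c s else 0)"
  by (simp add: lookup_sum lookup_single when_def)

lemma quotient_piece_dim_complementary_ideal:
  assumes "finite M" and vars: "\<And>t. t \<in> M \<Longrightarrow> Poly_Mapping.keys t \<subseteq> {..<r}"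
  shows "quotient_piece_dim r (complementary_ideal r M :: 'k::field mpoly set) i
    (card {t \<in> M. mon_degree t = i})"
  unfolding quotient_piece_dim_def
proof (intro exI conjI allI impI ballI)
  let ?I = "complementary_ideal r M :: 'k mpoly set"
  define N where "N = {t \<in> M. mon_degree t = i}"
  define e where "e = (\<lambda>t. Poly_Mapping.single t (1 :: 'k) :: 'k mpoly)"
  have inj: "inj_on e N"
    by (rule inj_on_inverseI[of _ "\<lambda>p. the_elem (Poly_Mapping.keys p)"]) (simp add: e_def)
  have "finite N" using \<open>finite M\<close> by (simp add: N_def)
  have combination: "(\<Sum>b\<in>e ` N. Poly_Mapping.single 0 (a b) * b) =
      (\<Sum>t\<in>N. Poly_Mapping.single t (a (e t)))" for a
    using inj by (simp add: sum.reindex) (simp add: e_def mult_single)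
  show "finite (e ` N)" using \<open>finite N\<close> by simp
  show "card (e ` N) = card {t \<in> M. mon_degree t = i}"
    using card_image[OF inj] by (simp add: N_def)
  show "e ` N \<subseteq> graded_piece r i"
    using vars by (fastforce simp: e_def N_def graded_piece_def mpoly_ring_def)
  show "a b = 0" if "(\<Sum>b\<in>e ` N. Poly_Mapping.single 0 (a b) * b) \<in> ?I" and "b \<in> e ` N" for a b
  proof -
    obtain t where "t \<in> N" "b = e t" using \<open>b \<in> e ` N\<close> by blast
    then have "t \<notin> Poly_Mapping.keys (\<Sum>t\<in>N. Poly_Mapping.single t (a (e t)))"
      using that(1) unfolding combination by (auto simp: complementary_ideal_def N_def)
    then show ?thesis
      using \<open>t \<in> N\<close> \<open>b = e t\<close> \<open>finite N\<close> by (simp add: in_keys_iff lookup_sum_single)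
  qed
  fix f :: "'k mpoly" assume "f \<in> graded_piece r i"
  let ?a = "\<lambda>b. Poly_Mapping.lookup f (inv_into N e b)"
  let ?p = "\<Sum>t\<in>N. Poly_Mapping.single t (Poly_Mapping.lookup f t)"
  have "Poly_Mapping.keys (f - ?p) = Poly_Mapping.keys f - N"
    using \<open>finite N\<close> by (auto simp: in_keys_iff lookup_minus lookup_sum_single split: if_splits)
  then have "f - ?p \<in> ?I"
    using \<open>f \<in> graded_piece r i\<close>
    by (auto simp: N_def complementary_ideal_def graded_piece_def mpoly_ring_def)
  moreover have "(\<Sum>b\<in>e ` N. Poly_Mapping.single 0 (?a b) * b) = ?p"
    unfolding combination using inj by (intro sum.cong) auto
  ultimately show "f - (\<Sum>b\<in>e ` N. Poly_Mapping.single 0 (?a b) * b) \<in> ?I" by (simp only:)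
qed

lemma M_vector_order_ideal:
  assumes "finite M" "order_ideal M" and degree: "\<And>t. t \<in> M \<Longrightarrow> mon_degree t \<le> d"
  shows "M_vector TYPE('k::field) d (\<lambda>i. of_nat (card {t \<in> M. mon_degree t = i}))"
proof -
  obtain r where vars: "(\<Union>t\<in>M. Poly_Mapping.keys t) \<subseteq> {..<r}"
    using finite_nat_bounded[of "\<Union>t\<in>M. Poly_Mapping.keys t"] \<open>finite M\<close> by auto
  let ?I = "complementary_ideal r M :: 'k mpoly set"
  have "1 \<notin> ?I" using \<open>order_ideal M\<close> by (auto simp: complementary_ideal_def order_ideal_def)
  moreover have "card {t \<in> M. mon_degree t = i} = 0" if "d < i" for i
    using degree that by (auto simp: card_eq_0_iff not_le[symmetric])
  moreover have "is_hilbert_function r ?I (\<lambda>i. card {t \<in> M. mon_degree t = i})"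
    unfolding is_hilbert_function_def
    using quotient_piece_dim_complementary_ideal[OF \<open>finite M\<close>] vars by blast
  moreover have "homogeneous_ideal r ?I"
    using \<open>order_ideal M\<close> by (rule homogeneous_complementary_ideal)
  ultimately show ?thesis
    unfolding M_vector_def by blast
qed

lemma M_vector_cong:
  assumes "\<And>i. i \<le> d \<Longrightarrow> m i = m' i"
  shows "M_vector TYPE('k::field) d m \<longleftrightarrow> M_vector TYPE('k) d m'"
  unfolding M_vector_def using assms by auto

definition monomial_growth :: "nat \<Rightarrow> nat \<Rightarrow> nat \<Rightarrow> bool" where
  "monomial_growth i a b \<longleftrightarrow>
    (\<exists>v. card (monomials v i) \<le> a \<and> b \<le> card (monomials v (Suc i)))"

text \<open>Squeezing the degree \<open>i + 1\<close> part between all monomials in \<open>v (i + 1)\<close> variables and all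
  monomials in \<open>v i\<close> variables makes the union an order ideal without any monomial order.\<close>

lemma order_ideal_with_degree_counts:
  assumes "g 0 = 1" and growth: "\<And>i. monomial_growth i (g i) (g (Suc i))"
  obtains M where "order_ideal M" and "\<And>i. card {t \<in> M. mon_degree t = i} = g i"
    and "\<And>i. finite {t \<in> M. mon_degree t = i}"
proof -
  obtain v where lower: "card (monomials (v i) i) \<le> g i"
    and upper: "g (Suc i) \<le> card (monomials (v i) (Suc i))" for i
    using growth unfolding monomial_growth_def by metis
  define w where "w i = v (i - 1)" for i
  have "\<exists>N. monomials (v i) i \<subseteq> N \<and> N \<subseteq> monomials (w i) i \<and> card N = g i" for i
  proof (rule exists_subset_between)
    show "g i \<le> card (monomials (w i) i)" using upper[of "i - 1"] \<open>g 0 = 1\<close>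
      by (cases i) (simp_all add: w_def)
    with lower[of i] show "monomials (v i) i \<subseteq> monomials (w i) i"
      by (intro monomials_subset_if_card_le) simp
  qed (use lower finite_monomials in auto)
  then obtain N where N_lower: "monomials (v i) i \<subseteq> N i"
    and N_upper: "N i \<subseteq> monomials (w i) i" and card_N: "card (N i) = g i" for i by metis
  define M where "M = (\<Union>i. N i)"
  have N_degree: "mon_degree t = i" if "t \<in> N i" for t i
    using N_upper that by (auto simp: monomials_def)
  then have M_part: "{t \<in> M. mon_degree t = i} = N i" for i
    by (auto simp: M_def)
  have "order_ideal M"
  proof (rule order_idealI_single)
    show "0 \<in> M" using N_lower[of 0] by (auto simp: M_def)
    fix s x assume "s + Poly_Mapping.single x 1 \<in> M"
    then obtain i where s_in: "s + Poly_Mapping.single x 1 \<in> N i" by (auto simp: M_def)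
    then have "s + Poly_Mapping.single x 1 \<in> monomials (w i) i" "i = Suc (mon_degree s)"
      using N_upper[of i] N_degree[OF s_in] by (auto simp: mon_degree_add)
    then have "s \<in> monomials (v (mon_degree s)) (mon_degree s)"
      by (auto simp: w_def monomials_def keys_add_nat)
    then show "s \<in> M" using N_lower by (auto simp: M_def)
  qed
  moreover have "finite (N i)" for i using N_upper finite_monomials by (rule finite_subset)
  ultimately show ?thesis using that M_part card_N by simp
qed

lemma M_vector_if_monomial_growth:
  assumes "g 0 = 1" and growth: "\<And>i. i < d \<Longrightarrow> monomial_growth i (g i) (g (Suc i))"
  shows "M_vector TYPE('k::field) d (\<lambda>i. of_nat (g i))"
proof -
  define g' where "g' i = (if i \<le> d then g i else 0)" for i
  have "g' 0 = 1" using \<open>g 0 = 1\<close> by (simp add: g'_def)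
  moreover have "monomial_growth i (g' i) (g' (Suc i))" for i
  proof (cases "i < d")
    case False
    then show ?thesis
      using \<open>g 0 = 1\<close> unfolding monomial_growth_def
      by (intro exI[of _ 0], cases i) (auto simp: g'_def card_monomials binomial_eq_0)
  qed (use growth in \<open>simp add: g'_def\<close>)
  ultimately obtain M where "order_ideal M"
    and card_part: "\<And>i. card {t \<in> M. mon_degree t = i} = g' i"
    and finite_part: "\<And>i. finite {t \<in> M. mon_degree t = i}"
    by (rule order_ideal_with_degree_counts) blast
  have degree: "mon_degree t \<le> d" if "t \<in> M" for t
  proof (rule ccontr)
    assume "\<not> mon_degree t \<le> d"
    then have "{s \<in> M. mon_degree s = mon_degree t} = {}"
      using card_part[of "mon_degree t"] finite_part[of "mon_degree t"] by (simp add: g'_def)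
    then show False using that by blast
  qed
  then have "M \<subseteq> (\<Union>i\<le>d. {t \<in> M. mon_degree t = i})" by blast
  moreover have "finite (\<Union>i\<le>d. {t \<in> M. mon_degree t = i})" using finite_part by simp
  ultimately have "finite M" by (rule finite_subset)
  then have "M_vector TYPE('k) d (\<lambda>i. of_nat (card {t \<in> M. mon_degree t = i}))"
    using \<open>order_ideal M\<close> degree by (rule M_vector_order_ideal)
  then show ?thesis by (rule M_vector_cong[THEN iffD1, rotated]) (simp add: card_part g'_def)
qed

section \<open>Eulerian numbers\<close>

fun eulerian :: "nat \<Rightarrow> nat \<Rightarrow> nat" where
  "eulerian 0 0 = 1"
| "eulerian 0 (Suc i) = 0"
| "eulerian (Suc m) 0 = eulerian m 0"
| "eulerian (Suc m) (Suc i) = (i + 2) * eulerian m (Suc i) + (m - i) * eulerian m i"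

lemmas eulerian_Suc_Suc = eulerian.simps(4)

declare eulerian_Suc_Suc [simp del]

lemma eulerian_0_right [simp]: "eulerian m 0 = 1"
  by (induction m) auto

lemma of_nat_eulerian_Suc_Suc:
  assumes "i \<le> m"
  shows "(of_nat (eulerian (Suc m) (Suc i)) :: 'a :: comm_ring_1) =
    (of_nat i + 2) * of_nat (eulerian m (Suc i)) + (of_nat m - of_nat i) * of_nat (eulerian m i)"
  using assms by (simp add: eulerian_Suc_Suc of_nat_diff distrib_right)

lemma eulerian_eq_0: "m \<le> i \<Longrightarrow> 0 < i \<Longrightarrow> eulerian m i = 0"
proof (induction m arbitrary: i)
  case 0
  then show ?case by (cases i) auto
next
  case (Suc m)
  then show ?case by (cases i) (auto simp: eulerian_Suc_Suc)
qed

lemma eulerian_last [simp]: "eulerian (Suc m) m = 1"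
  by (induction m) (auto simp: eulerian_Suc_Suc eulerian_eq_0)

lemma eulerian_symmetric: "m = Suc (i + j) \<Longrightarrow> eulerian m i = eulerian m j"
proof (induction m arbitrary: i j)
  case (Suc m)
  consider (left) "i = 0" | (right) "j = 0" | (inner) a b where "i = Suc a" "j = Suc b"
    by (metis not0_implies_Suc)
  then show ?case
  proof cases
    case (inner a b)
    then have "eulerian m (Suc a) = eulerian m b" "eulerian m a = eulerian m (Suc b)"
      using Suc.prems by (intro Suc.IH; simp)+
    then show ?thesis using inner Suc.prems by (simp add: eulerian_Suc_Suc)
  qed (use Suc.prems in auto)
qed simp

lemma eulerian_ratio_le:
  "2 * Suc i \<le> m \<Longrightarrow>
    (real m - real (Suc i)) * real (eulerian m i) \<le> real (Suc i) * real (eulerian m (Suc i))"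
proof (induction m arbitrary: i)
  case (Suc m)
  show ?case
  proof (cases i)
    case 0
    then show ?thesis by (simp add: eulerian_Suc_Suc)
  next
    case (Suc l)
    define a b c where "a = real (eulerian m (Suc i))" and "b = real (eulerian m i)"
      and "c = real (eulerian m l)"
    have two_steps:
      "(real m - real i) * ((real m - real l) * c) \<le> (real i + 1) * ((real i + 2) * a)"
    proof (cases "2 * Suc i \<le> m")
      case True
      have "(real m - real l) * ((real m - real i) * c) \<le> (real m - real l) * (real i * b)"
        using Suc.IH[of l] True \<open>i = Suc l\<close>
        by (intro mult_left_mono) (auto simp: b_def c_def algebra_simps)
      also have "\<dots> = ((real m - real l) * real i) * b" by simp
      also have "\<dots> \<le> ((real i + 2) * (real m - real i - 1)) * b"
        using True \<open>i = Suc l\<close> by (intro mult_right_mono) (auto simp: b_def algebra_simps)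
      also have "\<dots> = (real i + 2) * ((real m - real i - 1) * b)" by simp
      also have "\<dots> \<le> (real i + 2) * ((real i + 1) * a)"
        using Suc.IH[OF True] by (intro mult_left_mono) (auto simp: a_def b_def algebra_simps)
      finally show ?thesis by (simp add: mult_ac)
    next
      case False
      then have "m = Suc (2 * i)" using Suc.prems by simp
      then have "eulerian m (Suc i) = eulerian m l"
        using \<open>i = Suc l\<close> by (intro eulerian_symmetric) simp
      then show ?thesis
        using \<open>m = Suc (2 * i)\<close> \<open>i = Suc l\<close> by (simp add: a_def c_def mult_ac add_ac)
    qed
    have recurrence_Suc:
      "real (eulerian (Suc m) (Suc i)) = (real i + 2) * a + (real m - real i) * b"
      using Suc.prems by (simp add: a_def b_def of_nat_eulerian_Suc_Suc)
    have recurrence: "real (eulerian (Suc m) i) = (real i + 1) * b + (real m - real l) * c"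
      using Suc.prems \<open>i = Suc l\<close> by (simp add: c_def b_def of_nat_eulerian_Suc_Suc)
    show ?thesis unfolding recurrence_Suc recurrence using two_steps by (simp add: algebra_simps)
  qed
qed simp

lemma eulerian_mono:
  assumes "2 * Suc i \<le> m"
  shows "eulerian m i \<le> eulerian m (Suc i)"
proof -
  have "real (Suc i) * real (eulerian m i) \<le> (real m - real (Suc i)) * real (eulerian m i)"
    using assms by (intro mult_right_mono) auto
  also have "\<dots> \<le> real (Suc i) * real (eulerian m (Suc i))"
    by (rule eulerian_ratio_le[OF assms])
  finally show ?thesis by (simp del: of_nat_Suc)
qed

definition eulerian_diff :: "nat \<Rightarrow> nat \<Rightarrow> int" where
  "eulerian_diff m i = int (eulerian m i) - (if i = 0 then 0 else int (eulerian m (i - 1)))"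

lemma eulerian_diff_0_right [simp]: "eulerian_diff m 0 = 1"
  by (simp add: eulerian_diff_def)

lemma eulerian_diff_nonneg: "2 * i \<le> m \<Longrightarrow> 0 \<le> eulerian_diff m i"
  using eulerian_mono[of "i - 1" m] by (cases i) (auto simp: eulerian_diff_def)

lemma eulerian_diff_Suc_Suc:
  assumes "i \<le> m"
  shows "eulerian_diff (Suc m) (Suc i) =
    (int i + 2) * eulerian_diff m (Suc i) + (int m + 1 - int i) * eulerian_diff m i"
  using assms
  by (cases i) (simp_all add: eulerian_diff_def of_nat_eulerian_Suc_Suc algebra_simps)

lemma eulerian_diff_Suc_ge:
  assumes "2 * i \<le> m"
  shows "(int i + 1) * eulerian_diff m i \<le> eulerian_diff (Suc m) i"
proof (cases i)
  case (Suc j)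
  then have "0 \<le> (int m + 1 - int j) * eulerian_diff m j"
    using assms eulerian_diff_nonneg[of j m] by simp
  then show ?thesis using Suc assms by (simp add: eulerian_diff_Suc_Suc algebra_simps)
qed simp

lemma add_of_nat_le_mult_power:
  fixes a :: real
  assumes "0 < a"
  shows "a + real k \<le> a * ((a + 1) / a) ^ k"
proof -
  have "1 + real k * (1 / a) \<le> (1 + 1 / a) ^ k"
    using assms by (intro Bernoulli_inequality) (simp add: order_trans[of _ 0])
  then have "a * (1 + real k * (1 / a)) \<le> a * ((a + 1) / a) ^ k"
    using assms by (intro mult_left_mono) (simp_all add: add_divide_distrib add.commute)
  then show ?thesis using assms by (simp add: distrib_left)
qed

lemma eulerian_Suc_le:
  "real (eulerian (2 * i + 2 + k) (Suc i)) \<le>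
    (real k + 1) * ((real i + 2) / (real i + 1)) ^ k * real (eulerian (2 * i + 2 + k) i)"
proof (induction k)
  case 0
  have "eulerian (2 * i + 2) (Suc i) = eulerian (2 * i + 2) i"
    by (rule eulerian_symmetric) simp
  then show ?case by simp
next
  case (Suc k)
  define m y where "m = 2 * i + 2 + k" and "y = (real i + 2) / (real i + 1)"
  define a b where "a = real (eulerian m (Suc i))" and "b = real (eulerian m i)"
  have IH: "a \<le> (real k + 1) * y ^ k * b"
    using Suc.IH by (simp add: a_def b_def m_def y_def)
  have y_eq: "real i + 2 = y * (real i + 1)" and "y \<ge> 1" by (auto simp: y_def)
  have "real i + 1 + real k \<le> (real i + 1) * y ^ k"
    using add_of_nat_le_mult_power[of "real i + 1" k] by (simp add: y_def add_ac)
  moreover have "1 \<le> y ^ k" using \<open>y \<ge> 1\<close> by simp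
  ultimately have linear_le: "real i + 2 + real k \<le> (real i + 2) * y ^ k"
    by (simp add: algebra_simps)
  have "real (eulerian (Suc m) (Suc i)) = (real i + 2) * a + (real i + 2 + real k) * b"
    by (simp add: a_def b_def m_def of_nat_eulerian_Suc_Suc)
  also have "\<dots> \<le> (real i + 2) * ((real k + 1) * y ^ k * b) + (real i + 2) * y ^ k * b"
    using IH linear_le by (intro add_mono mult_left_mono mult_right_mono) (auto simp: b_def)
  also have "\<dots> = (real k + 2) * y ^ k * ((real i + 2) * b)" by (simp add: algebra_simps)
  also have "\<dots> = (real k + 2) * y ^ Suc k * ((real i + 1) * b)"
    by (simp add: y_eq algebra_simps)
  also have "\<dots> \<le> (real k + 2) * y ^ Suc k * real (eulerian (Suc m) i)"
    using \<open>y \<ge> 1\<close> by (intro mult_left_mono, cases i)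
      (auto simp: b_def eulerian_Suc_Suc algebra_simps)
  finally show ?case by (simp add: m_def y_def add_ac)
qed

lemma eulerian_le_diff:
  assumes "0 < i"
  shows "(real k + 2) * real (eulerian (2 * i + 2 + k) i)
    \<le> (real i + 2 + real k) * real_of_int (eulerian_diff (2 * i + 2 + k) i)"
  using eulerian_ratio_le[of "i - 1" "2 * i + 2 + k"] assms
  by (cases i) (simp_all add: eulerian_diff_def algebra_simps)

lemma eulerian_Suc_le_diff:
  assumes "0 < i"
  shows "real (eulerian (2 * i + 2 + k) (Suc i)) \<le>
    (real i + 2) * ((real i + 3) / (real i + 1)) ^ k *
      real_of_int (eulerian_diff (2 * i + 2 + k) i)"
proof -
  define m y z where "m = 2 * i + 2 + k" and "y = (real i + 2) / (real i + 1)"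
    and "z = (real i + 3) / (real i + 2)"
  define D where "D = real_of_int (eulerian_diff m i)"
  have "D \<ge> 0" by (simp add: D_def m_def eulerian_diff_nonneg)
  have "y > 0" by (simp add: y_def)
  have "(real k + 1) * real (eulerian m i) \<le> (real k + 2) * real (eulerian m i)"
    by (intro mult_right_mono) auto
  also have "\<dots> \<le> (real i + 2 + real k) * D"
    using eulerian_le_diff[OF assms, of k] by (simp add: m_def D_def)
  also have "\<dots> \<le> (real i + 2) * z ^ k * D"
    using add_of_nat_le_mult_power[of "real i + 2" k] \<open>D \<ge> 0\<close>
    by (intro mult_right_mono) (simp_all add: z_def add_ac)
  finally have eulerian_le: "(real k + 1) * real (eulerian m i) \<le> (real i + 2) * z ^ k * D" .
  have "real (eulerian m (Suc i)) \<le> y ^ k * ((real k + 1) * real (eulerian m i))"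
    using eulerian_Suc_le[of i k] by (simp add: m_def y_def mult_ac)
  also have "\<dots> \<le> y ^ k * ((real i + 2) * z ^ k * D)"
    using eulerian_le \<open>y > 0\<close> by (intro mult_left_mono) auto
  also have "\<dots> = (real i + 2) * (z * y) ^ k * D" by (simp add: power_mult_distrib)
  also have "z * y = (real i + 3) / (real i + 1)" by (simp add: y_def z_def)
  finally show ?thesis by (simp add: m_def D_def)
qed

definition multichoose :: "real \<Rightarrow> nat \<Rightarrow> real" where
  "multichoose x i = pochhammer x i / fact i"

lemma multichoose_0_right [simp]: "multichoose x 0 = 1"
  by (simp add: multichoose_def)

lemma multichoose_1_left: "multichoose 1 i = 1"
  by (simp add: multichoose_def flip: pochhammer_fact)

lemma multichoose_Suc: "multichoose x (Suc i) = (x + real i) / (real i + 1) * multichoose x i"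
  by (simp add: multichoose_def pochhammer_rec' add_ac)

lemma multichoose_Suc': "multichoose x (Suc i) = x / (real i + 1) * multichoose (x + 1) i"
  by (simp add: multichoose_def pochhammer_rec add_ac)

lemma multichoose_nonneg: "0 \<le> x \<Longrightarrow> 0 \<le> multichoose x i"
  by (induction i) (simp_all add: multichoose_Suc)

lemma multichoose_mono: "0 \<le> x \<Longrightarrow> x \<le> y \<Longrightarrow> multichoose x i \<le> multichoose y i"
  by (induction i)
    (auto simp: multichoose_Suc intro!: mult_mono divide_right_mono multichoose_nonneg)

lemma multichoose_scale_le:
  assumes "1 \<le> c" "0 \<le> x"
  shows "multichoose (c * x) i \<le> c ^ i * multichoose x i"
proof (induction i)
  case (Suc i)
  have "c * x + real i \<le> c * (x + real i)"
    using mult_right_mono[OF assms(1), of "real i"] by (simp add: algebra_simps)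
  then have "(c * x + real i) / (real i + 1) * multichoose (c * x) i \<le>
      c * (x + real i) / (real i + 1) * (c ^ i * multichoose x i)"
    using assms Suc.IH by (intro mult_mono divide_right_mono multichoose_nonneg) auto
  then show ?case by (simp add: multichoose_Suc mult_ac)
qed simp

lemma multichoose_of_nat: "multichoose (real v) i = real (card (monomials v i))"
proof (cases "v = 0")
  case True
  then show ?thesis by (cases i) (auto simp: multichoose_def pochhammer_0_left card_monomials)
next
  case False
  have "real (card (monomials v i)) = real (i + v - 1) gchoose i"
    by (simp add: card_monomials binomial_gbinomial)
  also have "real (i + v - 1) = real i + real v - 1" using False by (simp add: of_nat_diff)
  finally show ?thesis by (simp add: multichoose_def gbinomial_pochhammer')
qed

lemma power_ratio_le: "((real i + 3) / (real i + 1)) ^ i \<le> real i + 1"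
proof (cases "i \<ge> 8")
  case True
  have "(real i + 3) / (real i + 1) = 1 + 2 / (real i + 1)" by (simp add: field_simps)
  also have "\<dots> ^ i \<le> exp (2 / (real i + 1)) ^ i"
    by (intro power_mono exp_ge_add_one_self) simp_all
  also have "\<dots> = exp (real i * (2 / (real i + 1)))" by (rule exp_of_nat_mult [symmetric])
  also have "\<dots> \<le> exp (1 + 1)" by (simp add: field_simps)
  also have "\<dots> = exp 1 * exp (1 :: real)" by (rule exp_add)
  also have "\<dots> \<le> 3 * 3" by (intro mult_mono exp_le) auto
  also have "\<dots> \<le> real i + 1" using True by simp
  finally show ?thesis .
next
  case False
  then have "i \<in> {0, 1, 2, 3, 4, 5, 6, 7}" by auto
  then show ?thesis by (auto simp: power_divide divide_simps)
qed

lemma multichoose_ratio_le: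
  assumes "0 \<le> x"
  shows "multichoose ((real i + 3) / (real i + 1) * x) i \<le> (real i + 1) * multichoose x i"
proof -
  have "multichoose ((real i + 3) / (real i + 1) * x) i \<le>
      ((real i + 3) / (real i + 1)) ^ i * multichoose x i"
    using assms by (intro multichoose_scale_le) auto
  also have "\<dots> \<le> (real i + 1) * multichoose x i"
    using assms by (intro mult_right_mono power_ratio_le multichoose_nonneg)
  finally show ?thesis .
qed

lemma eulerian_diff_centre_Suc_ge:
  "((int i + 2) * (int i + 3) + (int i + 4) * (int i + 1)) * eulerian_diff (2 * i + 2) i
    \<le> eulerian_diff (2 * Suc i + 2) (Suc i)"
proof -
  define D where "D = eulerian_diff (2 * i + 2) i"
  have "eulerian (2 * i + 2) (Suc i) = eulerian (2 * i + 2) i" by (rule eulerian_symmetric) simp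
  then have "eulerian_diff (2 * i + 2) (Suc i) = 0" by (simp add: eulerian_diff_def)
  then have D_Suc: "eulerian_diff (2 * i + 3) (Suc i) = (int i + 3) * D"
    using eulerian_diff_Suc_Suc[of i "2 * i + 2"] by (simp add: D_def eval_nat_numeral)
  have "(int i + 1) * D \<le> eulerian_diff (2 * i + 3) i"
    using eulerian_diff_Suc_ge[of i "2 * i + 2"] by (simp add: D_def eval_nat_numeral)
  then have "(int i + 4) * ((int i + 1) * D) \<le> (int i + 4) * eulerian_diff (2 * i + 3) i"
    by (intro mult_left_mono) auto
  then have "((int i + 2) * (int i + 3) + (int i + 4) * (int i + 1)) * D \<le>
      (int i + 2) * ((int i + 3) * D) + (int i + 4) * eulerian_diff (2 * i + 3) i"
    by (simp add: algebra_simps)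
  also have "\<dots> = eulerian_diff (2 * Suc i + 2) (Suc i)"
    using eulerian_diff_Suc_Suc[of i "2 * i + 3"] D_Suc
    by (simp add: eval_nat_numeral algebra_simps)
  finally show ?thesis by (simp add: D_def)
qed

lemma multichoose_le_eulerian_diff_centre:
  "multichoose ((real i + 1) * (real i + 2) + 1) i \<le> real_of_int (eulerian_diff (2 * i + 2) i)"
proof (induction i)
  case (Suc i)
  define D where "D = real_of_int (eulerian_diff (2 * i + 2) i)"
  define u w where "u = (real i + 1) * (real i + 2) + 1" and "w = (real i + 2) * (real i + 3) + 1"
  have "u \<ge> 0" "w \<ge> 0" and w_le: "w \<le> (real i + 3) / (real i + 1) * u"
    by (auto simp: u_def w_def field_simps)
  have "D \<ge> 0" by (simp add: D_def eulerian_diff_nonneg)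
  have "multichoose w i \<le> multichoose ((real i + 3) / (real i + 1) * u) i"
    using \<open>w \<ge> 0\<close> w_le by (intro multichoose_mono)
  also have "\<dots> \<le> (real i + 1) * multichoose u i" using \<open>u \<ge> 0\<close> by (rule multichoose_ratio_le)
  also have "\<dots> \<le> (real i + 1) * D"
    using Suc.IH by (intro mult_left_mono) (auto simp: u_def D_def)
  finally have "multichoose w (Suc i) \<le> (w + real i) / (real i + 1) * ((real i + 1) * D)"
    unfolding multichoose_Suc using \<open>w \<ge> 0\<close> by (intro mult_left_mono) auto
  also have "\<dots> = (w + real i) * D" by simp
  also have "\<dots> \<le> ((real i + 2) * (real i + 3) + (real i + 4) * (real i + 1)) * D"
    using \<open>D \<ge> 0\<close> by (intro mult_right_mono) (auto simp: w_def algebra_simps)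
  also have "\<dots> = real_of_int
      (((int i + 2) * (int i + 3) + (int i + 4) * (int i + 1)) * eulerian_diff (2 * i + 2) i)"
    by (simp add: D_def)
  also have "\<dots> \<le> real_of_int (eulerian_diff (2 * Suc i + 2) (Suc i))"
    using eulerian_diff_centre_Suc_ge by (simp only: of_int_le_iff)
  finally show ?case by (simp add: w_def add_ac)
qed simp

text \<open>The first argument exceeds by at least 1 the number \<open>v\<close> for which \<open>v / (i + 1)\<close> is the
  growth factor in \<open>eulerian_Suc_le_diff\<close>.\<close>

lemma multichoose_le_eulerian_diff:
  "multichoose (((real i + 1) * (real i + 2) + 1) * ((real i + 3) / (real i + 1)) ^ k) i
    \<le> real_of_int (eulerian_diff (2 * i + 2 + k) i)"
proof (induction k)
  case 0
  show ?case using multichoose_le_eulerian_diff_centre[of i] by simp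
next
  case (Suc k)
  define u where "u = ((real i + 1) * (real i + 2) + 1) * ((real i + 3) / (real i + 1)) ^ k"
  have "multichoose ((real i + 3) / (real i + 1) * u) i \<le> (real i + 1) * multichoose u i"
    by (rule multichoose_ratio_le) (simp add: u_def)
  also have "\<dots> \<le> (real i + 1) * real_of_int (eulerian_diff (2 * i + 2 + k) i)"
    using Suc.IH by (intro mult_left_mono) (auto simp: u_def)
  also have "\<dots> = real_of_int ((int i + 1) * eulerian_diff (2 * i + 2 + k) i)" by simp
  also have "\<dots> \<le> real_of_int (eulerian_diff (2 * i + 2 + Suc k) i)"
    using eulerian_diff_Suc_ge[of i "2 * i + 2 + k"] by (simp only: of_int_le_iff) simp
  finally show ?case by (simp add: u_def mult_ac)
qed

lemma multichoose_bracket: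
  assumes "0 < i" "0 \<le> y"
  obtains v :: nat where "multichoose (real v) i \<le> y" "y < multichoose (real v + 1) i"
proof -
  obtain l where i_eq: "i = Suc l" using assms(1) by (cases i) auto
  obtain w :: nat where w_greater: "(real l + 1) * y < real w" using reals_Archimedean2 by blast
  have "1 \<le> multichoose (real w + 1) l"
    using multichoose_mono[of 1 "real w + 1" l] by (simp add: multichoose_1_left)
  have "y < real w / (real l + 1) * 1" using w_greater by (simp add: field_simps)
  also have "\<dots> \<le> real w / (real l + 1) * multichoose (real w + 1) l"
    using \<open>1 \<le> multichoose (real w + 1) l\<close> by (intro mult_left_mono) auto
  also have "\<dots> = multichoose (real w) i" by (simp add: i_eq multichoose_Suc')
  finally have "\<exists>v. y < multichoose (real v) i" by blast
  moreover have "\<not> y < multichoose (real 0) i" using assms(2) by (simp add: i_eq multichoose_Suc')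
  ultimately obtain v where "\<not> y < multichoose (real v) i" "y < multichoose (real (Suc v)) i"
    using exists_least_lemma[of "\<lambda>v. y < multichoose (real v) i"] by blast
  then show ?thesis using that[of v] by (simp add: add.commute)
qed

lemma monomial_growth_mono:
  "monomial_growth i a b \<Longrightarrow> a \<le> a' \<Longrightarrow> b' \<le> b \<Longrightarrow> monomial_growth i a' b'"
  unfolding monomial_growth_def by (blast intro: order_trans)

text \<open>Passing from degree \<open>i\<close> in \<open>v + 1\<close> variables to degree \<open>i + 1\<close> in \<open>v\<close> variables multiplies the
  number of monomials by \<open>v / (i + 1)\<close>, which exceeds the ratio of \<open>eulerian m (Suc i)\<close> and
  \<open>eulerian_diff m i\<close> for the \<open>v\<close> that brackets \<open>eulerian_diff m i\<close>.\<close>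

lemma monomial_growth_eulerian:
  assumes "2 * Suc i \<le> m"
  shows "monomial_growth i (nat (eulerian_diff m i)) (eulerian m (Suc i))"
proof (cases "i = 0")
  case True
  then show ?thesis unfolding monomial_growth_def
    by (intro exI[of _ "eulerian m 1"]) (simp add: card_monomials)
next
  case False
  define k where "k = m - (2 * i + 2)"
  have m_eq: "m = 2 * i + 2 + k" using assms by (simp add: k_def)
  define D x where "D = real_of_int (eulerian_diff m i)"
    and "x = ((real i + 3) / (real i + 1)) ^ k"
  define u where "u = ((real i + 1) * (real i + 2) + 1) * x"
  have "x \<ge> 1" by (simp add: x_def)
  have "D \<ge> 0" unfolding D_def using assms by (simp add: eulerian_diff_nonneg)
  obtain v where lower: "multichoose (real v) i \<le> D" and upper: "D < multichoose (real v + 1) i"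
    using multichoose_bracket[of i D] \<open>D \<ge> 0\<close> False by blast
  have "multichoose u i \<le> D"
    using multichoose_le_eulerian_diff[of i k] by (simp add: u_def x_def D_def m_eq)
  with upper have "\<not> real v + 1 \<le> u"
    using multichoose_mono[of "real v + 1" u i] by auto
  then have v_ge: "(real i + 1) * (real i + 2) * x \<le> real v"
    using \<open>x \<ge> 1\<close> by (simp add: u_def algebra_simps)
  have "real (eulerian m (Suc i)) \<le> (real i + 2) * x * D"
    using eulerian_Suc_le_diff[of i k] False by (simp add: m_eq D_def x_def)
  also have "\<dots> \<le> real v / (real i + 1) * D"
    using v_ge \<open>D \<ge> 0\<close> by (intro mult_right_mono) (auto simp: field_simps)
  also have "\<dots> \<le> real v / (real i + 1) * multichoose (real v + 1) i"
    using upper by (intro mult_left_mono) auto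
  also have "\<dots> = real (card (monomials v (Suc i)))"
    by (simp add: multichoose_Suc' flip: multichoose_of_nat)
  finally have "eulerian m (Suc i) \<le> card (monomials v (Suc i))" by simp
  moreover have "card (monomials v i) \<le> nat (eulerian_diff m i)"
    using lower by (simp add: multichoose_of_nat D_def le_nat_iff eulerian_diff_nonneg)
  ultimately show ?thesis unfolding monomial_growth_def by blast
qed

section \<open>Numerators of rational generating functions\<close>

definition numerator :: "nat \<Rightarrow> (nat \<Rightarrow> 'a::comm_ring_1) \<Rightarrow> 'a fps" where
  "numerator d f = (1 - fps_X) ^ d * Abs_fps f"

lemma one_minus_fps_X_mult_nth:
  "((1 - fps_X) * f :: 'a::comm_ring_1 fps) $ i = f $ i - (if i = 0 then 0 else f $ (i - 1))"
  by (simp add: left_diff_distrib)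

lemma numerator_Suc: "numerator (Suc d) f = (1 - fps_X) * numerator d f"
  by (simp add: numerator_def mult.assoc)

lemma numerator_add: "numerator d (\<lambda>k. f k + g k) = numerator d f + numerator d g"
  unfolding numerator_def distrib_left[symmetric]
  by (intro arg_cong[of _ _ "(*) _"] fps_ext) simp

lemma numerator_diff: "numerator d (\<lambda>k. f k - g k) = numerator d f - numerator d g"
  unfolding numerator_def right_diff_distrib[symmetric]
  by (intro arg_cong[of _ _ "(*) _"] fps_ext) simp

lemma numerator_sum: "numerator d (\<lambda>k. \<Sum>x\<in>A. f x k) = (\<Sum>x\<in>A. numerator d (f x))"
  unfolding numerator_def sum_distrib_left[symmetric]
  by (intro arg_cong[of _ _ "(*) _"] fps_ext) (simp add: fps_sum_nth)

lemma numerator_zero [simp]: "numerator d (\<lambda>_. 0) = 0"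
  by (simp add: numerator_def flip: fps_zero_def)

lemma numerator_one: "numerator 1 (\<lambda>_. 1) = 1"
  by (rule fps_ext) (simp add: numerator_def one_minus_fps_X_mult_nth)

lemma numerator_Suc_shift:
  assumes "f 0 = 0"
  shows "numerator d f = fps_X * numerator d (\<lambda>k. f (Suc k))"
proof -
  have "Abs_fps f = fps_X * Abs_fps (\<lambda>k. f (Suc k))"
    using assms by (intro fps_ext) simp
  then show ?thesis by (simp add: numerator_def mult_ac)
qed

lemma of_int_numerator_nth:
  "numerator d (\<lambda>k. of_int (f k)) $ i = (of_int (numerator d f $ i) :: 'a::comm_ring_1)"
proof (induction d arbitrary: i)
  case 0
  show ?case by (simp add: numerator_def)
qed (simp add: numerator_Suc one_minus_fps_X_mult_nth)

lemma numerator_convolution: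
  "numerator (d + e) (\<lambda>k. \<Sum>s<k. f s * g (k - s)) =
    numerator d f * (numerator e g - (1 - fps_X) ^ e * fps_const (g 0))"
proof -
  have convolution: "Abs_fps (\<lambda>k. \<Sum>s<k. f s * g (k - s)) =
      Abs_fps f * (Abs_fps g - fps_const (g 0))"
  proof (rule fps_ext)
    fix k
    have "(Abs_fps f * Abs_fps g) $ k = (\<Sum>s<k. f s * g (k - s)) + f k * g 0"
      by (simp add: fps_mult_nth atLeast0AtMost flip: lessThan_Suc_atMost)
    then show "Abs_fps (\<lambda>k. \<Sum>s<k. f s * g (k - s)) $ k =
        (Abs_fps f * (Abs_fps g - fps_const (g 0))) $ k"
      by (simp add: right_diff_distrib)
  qed
  show ?thesis unfolding numerator_def convolution power_add by (simp add: algebra_simps)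
qed

abbreviation eulerian_series :: "nat \<Rightarrow> int fps" where
  "eulerian_series m \<equiv> Abs_fps (\<lambda>i. int (eulerian m i))"

lemma eulerian_series_Suc:
  "eulerian_series (Suc m) = (1 - fps_X) * fps_deriv (fps_X * eulerian_series m) +
    of_nat (Suc m) * (fps_X * eulerian_series m)" (is "_ = ?rhs")
proof (rule fps_ext)
  fix i show "eulerian_series (Suc m) $ i = ?rhs $ i"
  proof (cases i)
    case (Suc l)
    have "?rhs $ i = (int l + 2) * int (eulerian m (Suc l)) + (int m - int l) * int (eulerian m l)"
      unfolding fps_add_nth one_minus_fps_X_mult_nth fps_mult_of_nat_nth
      by (simp add: Suc algebra_simps)
    then show ?thesis
      using Suc of_nat_eulerian_Suc_Suc[of l m, where ?'a = int]
      by (cases "l \<le> m") (simp_all add: eulerian_eq_0)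
  qed (simp add: one_minus_fps_X_mult_nth fps_mult_of_nat_nth del: of_nat_Suc)
qed

lemma numerator_power: "numerator (Suc m) (\<lambda>j. int (Suc j) ^ m) = eulerian_series m"
proof (induction m)
  case 0
  have "eulerian_series 0 = 1"
  proof (rule fps_ext)
    fix i show "eulerian_series 0 $ i = 1 $ i" by (cases i) auto
  qed
  then show ?case using numerator_one[where ?'a = int] by simp
next
  case (Suc m)
  define Y :: "int fps" where "Y = 1 - fps_X"
  define F where "F m = Abs_fps (\<lambda>j. int (Suc j) ^ m)" for m
  have IH: "eulerian_series m = Y ^ Suc m * F m"
    using Suc.IH by (simp add: numerator_def Y_def F_def del: power_Suc)
  have F_Suc: "F (Suc m) = fps_deriv (fps_X * F m)"
    by (rule fps_ext) (simp add: F_def algebra_simps)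
  have "fps_deriv (Y ^ Suc m) = - (of_nat (Suc m) * Y ^ m)"
    by (simp add: fps_deriv_power' Y_def algebra_simps del: power_Suc)
  then have deriv: "fps_deriv (fps_X * eulerian_series m) =
      Y ^ Suc m * F (Suc m) - of_nat (Suc m) * Y ^ m * (fps_X * F m)"
    using fps_deriv_mult[of "Y ^ Suc m" "fps_X * F m"]
    by (simp only: IH F_Suc mult.left_commute[of fps_X] mult_minus_left diff_conv_add_uminus)
  have "eulerian_series (Suc m) = Y ^ Suc (Suc m) * F (Suc m)"
    unfolding eulerian_series_Suc Y_def[symmetric] deriv unfolding IH by (simp add: algebra_simps)
  then show ?case by (simp add: numerator_def Y_def F_def)
qed

section \<open>Power series with centre of symmetry at least \<open>d / 2\<close>\<close>

inductive_set central_cone :: "nat \<Rightarrow> 'a::linordered_idom fps set" for d where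
  zero: "0 \<in> central_cone d"
| add: "f \<in> central_cone d \<Longrightarrow> g \<in> central_cone d \<Longrightarrow> f + g \<in> central_cone d"
| generator: "d \<le> 2 * p + q \<Longrightarrow> fps_X ^ p * (1 + fps_X) ^ q \<in> central_cone d"

lemma central_cone_antimono: "f \<in> central_cone d \<Longrightarrow> e \<le> d \<Longrightarrow> f \<in> central_cone e"
  by (induction rule: central_cone.induct) (auto intro: central_cone.intros)

lemma central_cone_sum: "(\<And>x. x \<in> A \<Longrightarrow> f x \<in> central_cone d) \<Longrightarrow> sum f A \<in> central_cone d"
  by (induction A rule: infinite_finite_induct) (auto intro: central_cone.intros)

lemma fps_X_in_central_cone: "fps_X \<in> central_cone 2"
  using central_cone.generator[of 2 1 0] by simp

lemma one_plus_fps_X_in_central_cone: "1 + fps_X \<in> central_cone 1"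
  using central_cone.generator[of 1 0 1] by simp

lemma central_cone_mult:
  assumes "f \<in> central_cone d" "g \<in> central_cone e"
  shows "f * g \<in> central_cone (d + e)"
  using assms(1)
proof (induction rule: central_cone.induct)
  case (generator p q)
  from assms(2) show ?case
  proof (induction rule: central_cone.induct)
    case (generator p' q')
    have "(fps_X ^ p * (1 + fps_X) ^ q) * (fps_X ^ p' * (1 + fps_X) ^ q') =
        (fps_X ^ (p + p') * (1 + fps_X) ^ (q + q') :: 'a fps)"
      by (simp add: power_add mult_ac)
    then show ?case
      using generator \<open>d \<le> 2 * p + q\<close> by (auto intro!: central_cone.generator)
  qed (auto simp: distrib_left intro: central_cone.intros)
qed (auto simp: distrib_right intro: central_cone.intros)

lemma one_plus_fps_X_power_nth: "((1 + fps_X) ^ q :: 'a::comm_ring_1 fps) $ k = of_nat (q choose k)"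
proof (induction q arbitrary: k)
  case 0
  show ?case by (cases k) simp_all
next
  case (Suc q)
  then show ?case by (cases k) (simp_all add: distrib_right)
qed

lemma central_cone_generator_nth:
  "(fps_X ^ p * (1 + fps_X) ^ q :: 'a::comm_ring_1 fps) $ i =
    (if i < p then 0 else of_nat (q choose (i - p)))"
  by (simp add: fps_X_power_mult_nth one_plus_fps_X_power_nth)

lemma central_cone_nth_nonneg: "f \<in> central_cone d \<Longrightarrow> 0 \<le> f $ i"
  by (induction rule: central_cone.induct) (auto simp: central_cone_generator_nth)

lemma binomial_le_if_add_le:
  assumes "a \<le> b" "a + b \<le> q"
  shows "q choose a \<le> q choose b"
proof (cases "2 * b \<le> q")
  case False
  have "b \<le> q" using assms by simp
  then have "q choose b = q choose (q - b)" by (rule binomial_symmetric)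
  then show ?thesis using assms False by (simp add: binomial_mono)
qed (use assms in \<open>simp add: binomial_mono\<close>)

lemma central_cone_nth_le:
  assumes "f \<in> central_cone d" "i \<le> j" "i + j \<le> d"
  shows "f $ i \<le> f $ j"
  using assms(1)
proof (induction rule: central_cone.induct)
  case (generator p q)
  have "q choose (i - p) \<le> q choose (j - p)" if "p \<le> i"
    using that assms(2,3) generator by (intro binomial_le_if_add_le) auto
  then show ?case using assms(2) by (simp add: central_cone_generator_nth)
qed (auto intro: add_mono)

section \<open>Strict maps of digraphs\<close>

lemma card_eq_sum_fibres:
  assumes "finite A" "finite B" "f ` A \<subseteq> B"
  shows "card A = (\<Sum>y\<in>B. card {x \<in> A. f x = y})"
  using sum.group[OF assms, of "\<lambda>_. 1 :: nat"] by simp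

lemma card_PiE_determined_value:
  assumes "v \<in> V" and range: "\<And>c. c \<in> (V - {v}) \<rightarrow>\<^sub>E S \<Longrightarrow> f c \<in> S"
    and independent: "\<And>c x. f (c(v := x)) = f c"
  shows "card {c \<in> V \<rightarrow>\<^sub>E S. c v = f c \<and> P c} = card {c \<in> (V - {v}) \<rightarrow>\<^sub>E S. P (c(v := f c))}"
proof (rule bij_betw_same_card[of "\<lambda>c. c(v := undefined)"],
    rule bij_betw_byWitness[of _ "\<lambda>c. c(v := f c)"])
  show "(\<lambda>c. c(v := undefined)) ` {c \<in> V \<rightarrow>\<^sub>E S. c v = f c \<and> P c}
      \<subseteq> {c \<in> (V - {v}) \<rightarrow>\<^sub>E S. P (c(v := f c))}"
    by (auto simp: independent PiE_iff extensional_def fun_upd_idem split: if_splits)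
  show "(\<lambda>c. c(v := f c)) ` {c \<in> (V - {v}) \<rightarrow>\<^sub>E S. P (c(v := f c))}
      \<subseteq> {c \<in> V \<rightarrow>\<^sub>E S. c v = f c \<and> P c}"
    using \<open>v \<in> V\<close> range by (auto simp: independent PiE_iff extensional_def)
  show "\<forall>c\<in>{c \<in> (V - {v}) \<rightarrow>\<^sub>E S. P (c(v := f c))}. (c(v := f c))(v := undefined) = c"
    by (auto simp: PiE_iff extensional_def fun_eq_iff)
qed (auto simp: independent)

definition strict_maps :: "'a set \<Rightarrow> 'a rel \<Rightarrow> nat \<Rightarrow> ('a \<Rightarrow> nat) set" where
  "strict_maps V R k = {c \<in> V \<rightarrow>\<^sub>E {..<k}. \<forall>x\<in>V. \<forall>y\<in>V. (x, y) \<in> R \<longrightarrow> c x < c y}"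

lemma finite_strict_maps: "finite V \<Longrightarrow> finite (strict_maps V R k)"
  unfolding strict_maps_def by (rule finite_subset[of _ "V \<rightarrow>\<^sub>E {..<k}"]) (auto intro: finite_PiE)

lemma strict_maps_insert:
  "u \<in> V \<Longrightarrow> v \<in> V \<Longrightarrow>
    strict_maps V (insert (u, v) R) k = {c \<in> strict_maps V R k. c u < c v}"
  by (auto simp: strict_maps_def)

lemma strict_maps_empty [simp]: "strict_maps {} R k = {\<lambda>_. undefined}"
  by (auto simp: strict_maps_def)

lemma strict_maps_0: "V \<noteq> {} \<Longrightarrow> strict_maps V R 0 = {}"
  by (auto simp: strict_maps_def PiE_eq_empty_iff)

lemma strict_maps_eq_empty_if_no_sink:
  assumes "finite V" "V \<noteq> {}" "\<And>x. x \<in> V \<Longrightarrow> \<exists>y\<in>V. (x, y) \<in> R"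
  shows "strict_maps V R k = {}"
proof (rule ccontr)
  assume "strict_maps V R k \<noteq> {}"
  then obtain c where strict: "c \<in> strict_maps V R k" by auto
  have "Max (c ` V) \<in> c ` V" using assms(1,2) by (intro Max_in) auto
  then obtain x where "x \<in> V" and max: "c x = Max (c ` V)" by force
  obtain y where "y \<in> V" "(x, y) \<in> R" using assms(3) \<open>x \<in> V\<close> by blast
  then have "c x < c y" using strict \<open>x \<in> V\<close> by (auto simp: strict_maps_def)
  moreover have "c y \<le> Max (c ` V)" using \<open>y \<in> V\<close> assms(1) by auto
  ultimately show False using max by simp
qed

lemma card_strict_maps_value_at_sink:
  assumes "n \<in> V" and sink: "\<And>y. y \<in> V \<Longrightarrow> (n, y) \<notin> R" and "s < k"
  shows "card {c \<in> strict_maps V R k. c n = s} =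
    card {c \<in> strict_maps (V - {n}) R k. \<forall>x\<in>V - {n}. (x, n) \<in> R \<longrightarrow> c x < s}"
proof -
  define P where "P c \<longleftrightarrow> (\<forall>x\<in>V. \<forall>y\<in>V. (x, y) \<in> R \<longrightarrow> c x < c y)" for c :: "'a \<Rightarrow> nat"
  have "{c \<in> strict_maps V R k. c n = s} = {c \<in> V \<rightarrow>\<^sub>E {..<k}. c n = s \<and> P c}"
    by (auto simp: strict_maps_def P_def)
  also have "card \<dots> = card {c \<in> (V - {n}) \<rightarrow>\<^sub>E {..<k}. P (c(n := s))}"
    using assms by (intro card_PiE_determined_value) auto
  also have "{c \<in> (V - {n}) \<rightarrow>\<^sub>E {..<k}. P (c(n := s))} =
      {c \<in> strict_maps (V - {n}) R k. \<forall>x\<in>V - {n}. (x, n) \<in> R \<longrightarrow> c x < s}"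
    using assms(1) sink by (auto simp: strict_maps_def P_def)
  finally show ?thesis .
qed

definition stack_maps :: "'a set \<Rightarrow> 'a set \<Rightarrow> nat \<Rightarrow> ('a \<Rightarrow> nat) \<times> ('a \<Rightarrow> nat) \<Rightarrow> 'a \<Rightarrow> nat" where
  "stack_maps V I s = (\<lambda>(a, b). restrict (\<lambda>x. if x \<in> I then a x else b x + s) V)"

lemma stack_maps_strict:
  assumes "I \<subseteq> V" and no_arc: "\<And>x y. x \<in> V - I \<Longrightarrow> y \<in> I \<Longrightarrow> (x, y) \<notin> R" and "s \<le> k"
    and lower: "a \<in> strict_maps I R s" and upper: "b \<in> strict_maps (V - I) R (k - s)"
  shows "stack_maps V I s (a, b) \<in> strict_maps V R k"
    and "{x \<in> V. stack_maps V I s (a, b) x < s} = I"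
proof -
  let ?c = "stack_maps V I s (a, b)"
  have a_less: "a x < s" if "x \<in> I" for x using lower that by (auto simp: strict_maps_def)
  have b_less: "b x < k - s" if "x \<in> V - I" for x using upper that by (auto simp: strict_maps_def)
  have on_I: "?c x = a x" if "x \<in> I" for x
    using that \<open>I \<subseteq> V\<close> by (auto simp: stack_maps_def)
  have off_I: "?c x = b x + s" if "x \<in> V - I" for x
    using that by (auto simp: stack_maps_def)
  show "{x \<in> V. ?c x < s} = I"
    using a_less on_I off_I \<open>I \<subseteq> V\<close> by fastforce
  have "?c x < k" if "x \<in> V" for x
    using that a_less[of x] b_less[of x] on_I[of x] off_I[of x] \<open>s \<le> k\<close>
    by (cases "x \<in> I") auto
  moreover have "?c x < ?c y" if "x \<in> V" "y \<in> V" "(x, y) \<in> R" for x y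
    using that no_arc[of x y] lower upper a_less[of x]
    by (cases "x \<in> I"; cases "y \<in> I") (auto simp: on_I off_I strict_maps_def)
  ultimately show "?c \<in> strict_maps V R k"
    by (auto simp: strict_maps_def PiE_iff) (simp add: stack_maps_def)
qed

lemma card_strict_maps_split:
  assumes "I \<subseteq> V" and no_arc: "\<And>x y. x \<in> V - I \<Longrightarrow> y \<in> I \<Longrightarrow> (x, y) \<notin> R" and "s \<le> k"
  shows "card {c \<in> strict_maps V R k. {x \<in> V. c x < s} = I} =
    card (strict_maps I R s) * card (strict_maps (V - I) R (k - s))"
proof -
  let ?A = "{c \<in> strict_maps V R k. {x \<in> V. c x < s} = I}"
  let ?B = "strict_maps I R s \<times> strict_maps (V - I) R (k - s)"
  define split where "split c = (restrict c I, restrict (\<lambda>x. c x - s) (V - I))" for c :: "'a \<Rightarrow> nat"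
  have "bij_betw split ?A ?B"
  proof (rule bij_betw_byWitness[of _ "stack_maps V I s"])
    have low: "x \<in> I \<longleftrightarrow> c x < s" if "c \<in> ?A" "x \<in> V" for c x using that by blast
    show "\<forall>c\<in>?A. stack_maps V I s (split c) = c"
    proof
      fix c assume "c \<in> ?A"
      then show "stack_maps V I s (split c) = c"
        using low by (intro extensionalityI[of _ V])
          (auto simp: stack_maps_def split_def strict_maps_def PiE_def)
    qed
    show "split ` ?A \<subseteq> ?B"
    proof (rule image_subsetI)
      fix c assume "c \<in> ?A"
      then have "restrict c I \<in> strict_maps I R s"
        and "restrict (\<lambda>x. c x - s) (V - I) \<in> strict_maps (V - I) R (k - s)"
        using low \<open>I \<subseteq> V\<close> by (auto simp: strict_maps_def not_less intro!: diff_less_mono)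
      then show "split c \<in> ?B" by (simp add: split_def)
    qed
    show "stack_maps V I s ` ?B \<subseteq> ?A"
      by clarify (intro CollectI conjI stack_maps_strict[OF assms])
    show "\<forall>p\<in>?B. split (stack_maps V I s p) = p"
    proof clarify
      fix a b assume lower: "a \<in> strict_maps I R s" and upper: "b \<in> strict_maps (V - I) R (k - s)"
      have "restrict (stack_maps V I s (a, b)) I = a"
        using lower \<open>I \<subseteq> V\<close> by (intro extensionalityI[of _ I])
          (auto simp: stack_maps_def strict_maps_def PiE_def)
      moreover have "restrict (\<lambda>x. stack_maps V I s (a, b) x - s) (V - I) = b"
        using upper by (intro extensionalityI[of _ "V - I"])
          (auto simp: stack_maps_def strict_maps_def PiE_def)
      ultimately show "split (stack_maps V I s (a, b)) = (a, b)" by (simp add: split_def)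
    qed
  qed
  then show ?thesis by (simp add: bij_betw_same_card card_cartesian_product)
qed

text \<open>For a sink \<open>n\<close>, these are the possible sets of vertices that receive a smaller value
  than \<open>n\<close>.\<close>

definition lower_parts :: "'a set \<Rightarrow> 'a rel \<Rightarrow> 'a \<Rightarrow> 'a set set" where
  "lower_parts V R n = {I. I \<subseteq> V - {n} \<and> (\<forall>x\<in>V - {n}. (x, n) \<in> R \<longrightarrow> x \<in> I) \<and>
     (\<forall>x\<in>V - {n} - I. \<forall>y\<in>I. (x, y) \<notin> R)}"

lemma finite_lower_parts: "finite V \<Longrightarrow> finite (lower_parts V R n)"
  by (rule finite_subset[of _ "Pow V"]) (auto simp: lower_parts_def)

lemma card_strict_maps_sink:
  assumes "finite V" "n \<in> V" and sink: "\<And>y. y \<in> V \<Longrightarrow> (n, y) \<notin> R"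
  shows "card (strict_maps V R k) = (\<Sum>I\<in>lower_parts V R n. \<Sum>s<k.
    card (strict_maps I R s) * card (strict_maps (V - {n} - I) R (k - s)))"
proof -
  define low where "low s c = {x \<in> V - {n}. c x < s}" for s and c :: "'a \<Rightarrow> nat"
  define B where "B s = {c \<in> strict_maps (V - {n}) R k. \<forall>x\<in>V - {n}. (x, n) \<in> R \<longrightarrow> c x < s}" for s
  have card_B: "card (B s) = (\<Sum>I\<in>lower_parts V R n.
      card (strict_maps I R s) * card (strict_maps (V - {n} - I) R (k - s)))" if "s < k" for s
  proof -
    have "low s c \<in> lower_parts V R n" if "c \<in> B s" for c
      using that unfolding B_def lower_parts_def low_def strict_maps_def by fastforce
    then have "card (B s) = (\<Sum>I\<in>lower_parts V R n. card {c \<in> B s. low s c = I})"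
      using \<open>finite V\<close>
      by (intro card_eq_sum_fibres finite_lower_parts) (auto simp: B_def finite_strict_maps)
    moreover have "card {c \<in> B s. low s c = I} =
        card (strict_maps I R s) * card (strict_maps (V - {n} - I) R (k - s))"
      if I: "I \<in> lower_parts V R n" for I
    proof -
      have "{c \<in> B s. low s c = I} =
          {c \<in> strict_maps (V - {n}) R k. {x \<in> V - {n}. c x < s} = I}"
        using I by (auto simp: B_def low_def lower_parts_def)
      then show ?thesis
        using I \<open>s < k\<close> card_strict_maps_split[of I "V - {n}" R s k] by (auto simp: lower_parts_def)
    qed
    ultimately show ?thesis by simp
  qed
  have "card (strict_maps V R k) = (\<Sum>s<k. card {c \<in> strict_maps V R k. c n = s})"
    using \<open>finite V\<close> \<open>n \<in> V\<close>
    by (intro card_eq_sum_fibres finite_strict_maps) (auto simp: strict_maps_def)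
  also have "\<dots> = (\<Sum>s<k. card (B s))"
    using \<open>n \<in> V\<close> sink by (intro sum.cong) (auto simp: B_def card_strict_maps_value_at_sink)
  also have "\<dots> = (\<Sum>s<k. \<Sum>I\<in>lower_parts V R n.
      card (strict_maps I R s) * card (strict_maps (V - {n} - I) R (k - s)))"
    using card_B by simp
  finally show ?thesis by (simp only: sum.swap[of _ "lower_parts V R n"])
qed

definition strict_numerator :: "'a set \<Rightarrow> 'a rel \<Rightarrow> int fps" where
  "strict_numerator V R = numerator (card V + 1) (\<lambda>k. int (card (strict_maps V R k)))"

lemma strict_numerator_empty [simp]: "strict_numerator {} R = 1"
  using numerator_one[where ?'a = int] by (simp add: strict_numerator_def)

definition sink_summand :: "'a set \<Rightarrow> 'a rel \<Rightarrow> 'a set \<Rightarrow> int fps" where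
  "sink_summand U R I =
     strict_numerator I R * (if U - I = {} then fps_X else strict_numerator (U - I) R)"

lemma strict_numerator_sink:
  assumes "finite V" "n \<in> V" and sink: "\<And>y. y \<in> V \<Longrightarrow> (n, y) \<notin> R"
  shows "strict_numerator V R = (\<Sum>I\<in>lower_parts V R n. sink_summand (V - {n}) R I)"
proof -
  define count where "count J = (\<lambda>k. int (card (strict_maps J R k)))" for J
  have "strict_numerator V R = (\<Sum>I\<in>lower_parts V R n.
      numerator (card V + 1) (\<lambda>k. \<Sum>s<k. count I s * count (V - {n} - I) (k - s)))"
    unfolding numerator_sum[symmetric]
    by (simp add: strict_numerator_def card_strict_maps_sink[OF assms] count_def)
  also have "\<dots> = (\<Sum>I\<in>lower_parts V R n. sink_summand (V - {n}) R I)"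
  proof (rule sum.cong)
    fix I assume "I \<in> lower_parts V R n"
    moreover define J where "J = V - {n} - I"
    ultimately have "card (V - {n}) = card I + card J"
      using card_Int_Diff[of "V - {n}" I] assms(1) by (simp add: lower_parts_def Int_absorb1)
    then have card_V: "card V + 1 = (card I + 1) + (card J + 1)"
      using card.remove[OF assms(1,2)] by simp
    have "numerator (card V + 1) (\<lambda>k. \<Sum>s<k. count I s * count J (k - s)) =
        strict_numerator I R *
        (strict_numerator J R - (1 - fps_X) ^ (card J + 1) * fps_const (count J 0))"
      unfolding card_V strict_numerator_def count_def[symmetric] by (rule numerator_convolution)
    also have "strict_numerator J R - (1 - fps_X) ^ (card J + 1) * fps_const (count J 0) =
        (if J = {} then fps_X else strict_numerator J R)"
      by (simp add: count_def strict_maps_0)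
    finally show "numerator (card V + 1) (\<lambda>k. \<Sum>s<k. count I s * count (V - {n} - I) (k - s)) =
        sink_summand (V - {n}) R I"
      by (simp only: sink_summand_def J_def)
  qed simp
  finally show ?thesis .
qed

lemma sink_summand_in_central_cone:
  assumes "finite U" "I \<subseteq> U" "I \<noteq> U" "strict_numerator I R \<in> central_cone (card I + 1)"
    and "strict_numerator (U - I) R \<in> central_cone (card (U - I) + 1)"
  shows "sink_summand U R I \<in> central_cone (card U + 2)"
proof -
  have "card U + 2 = (card I + 1) + (card (U - I) + 1)"
    using card_Int_Diff[OF assms(1), of I] assms(2) by (simp add: Int_absorb1)
  moreover have "U - I \<noteq> {}" using assms(2,3) by blast
  ultimately show ?thesis
    using central_cone_mult[OF assms(4,5)] by (simp add: sink_summand_def)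
qed

text \<open>The summand of \<open>{}\<close> alone is only in \<open>central_cone (card U + 1)\<close>, because the numerator of
  the empty digraph is 1; paired with the summand of \<open>U\<close> it gains the factor \<open>1 + fps_X\<close>.\<close>

lemma sum_extreme_sink_summands_in_central_cone:
  assumes "U \<in> L" and numerator_U: "U \<noteq> {} \<Longrightarrow> strict_numerator U R \<in> central_cone (card U + 1)"
  shows "sum (sink_summand U R) (L \<inter> {{}, U}) \<in> central_cone (card U + 2)"
proof (cases "U = {}")
  case True
  then have "L \<inter> {{}, U} = {{}}" using \<open>U \<in> L\<close> by auto
  then show ?thesis
    using True fps_X_in_central_cone by (simp add: sink_summand_def numeral_2_eq_2)
next
  case False
  consider (with_empty) "L \<inter> {{}, U} = {{}, U}" | (without_empty) "L \<inter> {{}, U} = {U}"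
    using \<open>U \<in> L\<close> by auto
  then show ?thesis
  proof cases
    case with_empty
    then have "sum (sink_summand U R) (L \<inter> {{}, U}) = (1 + fps_X) * strict_numerator U R"
      using False by (simp add: sink_summand_def distrib_right mult.commute)
    then show ?thesis
      using central_cone_mult[OF one_plus_fps_X_in_central_cone numerator_U[OF False]] by simp
  next
    case without_empty
    then have "sum (sink_summand U R) (L \<inter> {{}, U}) \<in> central_cone (card U + 1 + 2)"
      using central_cone_mult[OF numerator_U[OF False] fps_X_in_central_cone]
      by (simp add: sink_summand_def)
    then show ?thesis by (rule central_cone_antimono) simp
  qed
qed

lemma strict_numerator_sink_in_central_cone:
  assumes "finite V" "n \<in> V" and sink: "\<And>y. y \<in> V \<Longrightarrow> (n, y) \<notin> R"
    and parts: "\<And>I. I \<subseteq> V - {n} \<Longrightarrow> I \<noteq> {} \<Longrightarrow> strict_numerator I R \<in> central_cone (card I + 1)"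
  shows "strict_numerator V R \<in> central_cone (card V + 1)"
proof -
  define U L where "U = V - {n}" and "L = lower_parts V R n"
  have "finite U" and card_V: "card V + 1 = card U + 2"
    using assms(1) card.remove[OF assms(1,2)] by (auto simp: U_def)
  have "U \<in> L" using sink by (auto simp: L_def U_def lower_parts_def)
  then have "sum (sink_summand U R) (L \<inter> {{}, U}) \<in> central_cone (card U + 2)"
    using parts by (intro sum_extreme_sink_summands_in_central_cone) (auto simp: U_def)
  moreover have "sum (sink_summand U R) (L - {{}, U}) \<in> central_cone (card U + 2)"
  proof (rule central_cone_sum)
    fix I assume "I \<in> L - {{}, U}"
    then have "I \<subseteq> U" "I \<noteq> U" "I \<noteq> {}" "U - I \<noteq> {}"
      by (auto simp: L_def U_def lower_parts_def)
    then show "sink_summand U R I \<in> central_cone (card U + 2)"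
      using \<open>finite U\<close> parts by (intro sink_summand_in_central_cone) (auto simp: U_def)
  qed
  moreover have "strict_numerator V R = sum (sink_summand U R) L"
    unfolding U_def L_def using assms(1,2) sink by (rule strict_numerator_sink)
  moreover have "sum (sink_summand U R) L =
      sum (sink_summand U R) (L \<inter> {{}, U}) + sum (sink_summand U R) (L - {{}, U})"
    using assms(1) by (intro sum.Int_Diff) (simp add: L_def finite_lower_parts)
  ultimately show ?thesis unfolding card_V by (simp only: central_cone.add)
qed

lemma strict_numerator_in_central_cone:
  assumes "finite V" "V \<noteq> {}"
  shows "strict_numerator V R \<in> central_cone (card V + 1)"
  using assms
proof (induction "card V" arbitrary: V rule: less_induct)
  case less
  show ?case
  proof (cases "\<exists>n\<in>V. \<forall>y\<in>V. (n, y) \<notin> R")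
    case True
    then obtain n where "n \<in> V" and sink: "\<And>y. y \<in> V \<Longrightarrow> (n, y) \<notin> R" by auto
    show ?thesis
    proof (rule strict_numerator_sink_in_central_cone[OF less.prems(1) \<open>n \<in> V\<close> sink])
      fix I assume "I \<subseteq> V - {n}" "I \<noteq> {}"
      moreover from this have "card I < card V"
        using \<open>n \<in> V\<close> less.prems(1) by (intro psubset_card_mono) auto
      ultimately show "strict_numerator I R \<in> central_cone (card I + 1)"
        using less.prems(1) by (intro less.hyps) (auto dest: finite_subset)
    qed
  next
    case False
    then have "strict_maps V R k = {}" for k
      using less.prems by (intro strict_maps_eq_empty_if_no_sink) auto
    then show ?thesis by (simp add: strict_numerator_def central_cone.zero)
  qed
qed

section \<open>Proper colourings\<close>

definition proper_maps :: "'a set \<Rightarrow> 'a rel \<Rightarrow> 'c set \<Rightarrow> ('a \<Rightarrow> 'c) set" where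
  "proper_maps V E S = {c \<in> V \<rightarrow>\<^sub>E S. \<forall>(x, y)\<in>E. c x \<noteq> c y}"

lemma finite_proper_maps: "finite V \<Longrightarrow> finite S \<Longrightarrow> finite (proper_maps V E S)"
  unfolding proper_maps_def by (rule finite_subset[of _ "V \<rightarrow>\<^sub>E S"]) (auto intro: finite_PiE)

lemma proper_maps_insert:
  "proper_maps V (insert (u, v) E) S = {c \<in> proper_maps V E S. c u \<noteq> c v}"
  by (auto simp: proper_maps_def)

lemma card_proper_maps_no_arcs: "finite V \<Longrightarrow> card (proper_maps V {} S) = card S ^ card V"
  by (simp add: proper_maps_def card_funcsetE)

lemma card_proper_maps_le: "finite V \<Longrightarrow> finite S \<Longrightarrow> card (proper_maps V E S) \<le> card S ^ card V"
  using card_mono[of "V \<rightarrow>\<^sub>E S" "proper_maps V E S"]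
  by (auto simp: proper_maps_def card_funcsetE intro: finite_PiE)

definition contract :: "'a \<Rightarrow> 'a \<Rightarrow> 'a rel \<Rightarrow> 'a rel" where
  "contract u v E = map_prod (id(v := u)) (id(v := u)) ` E"

lemma contract_subset:
  assumes "u \<in> V" "u \<noteq> v" "E \<subseteq> V \<times> V"
  shows "contract u v E \<subseteq> (V - {v}) \<times> (V - {v})"
  using assms by (auto simp: contract_def split: if_splits)

lemma card_proper_maps_insert_contract:
  assumes "finite V" "finite S" "u \<in> V" "v \<in> V" "u \<noteq> v"
  shows "card (proper_maps V (insert (u, v) E) S) +
    card (proper_maps (V - {v}) (contract u v E) S) = card (proper_maps V E S)"
proof -
  define P where "P c \<longleftrightarrow> (\<forall>(x, y)\<in>E. c x \<noteq> c y)" for c :: "'a \<Rightarrow> 'b"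
  have "{c \<in> proper_maps V E S. c u = c v} = {c \<in> V \<rightarrow>\<^sub>E S. c v = c u \<and> P c}"
    by (auto simp: proper_maps_def P_def)
  also have "card \<dots> = card {c \<in> (V - {v}) \<rightarrow>\<^sub>E S. P (c(v := c u))}"
    using assms by (intro card_PiE_determined_value) auto
  also have "{c \<in> (V - {v}) \<rightarrow>\<^sub>E S. P (c(v := c u))} = proper_maps (V - {v}) (contract u v E) S"
  proof -
    define r where "r = id(v := u)"
    have "c(v := c u) = c \<circ> r" for c :: "'a \<Rightarrow> 'b" by (auto simp: r_def)
    moreover have "P (c \<circ> r) \<longleftrightarrow> (\<forall>(x, y)\<in>contract u v E. c x \<noteq> c y)" for c
      by (auto simp: P_def contract_def simp flip: r_def)
    ultimately show ?thesis by (simp add: proper_maps_def)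
  qed
  finally have "card {c \<in> proper_maps V E S. c u = c v} =
      card (proper_maps (V - {v}) (contract u v E) S)" .
  moreover have "card (proper_maps V E S) =
      card {c \<in> proper_maps V E S. c u \<noteq> c v} + card {c \<in> proper_maps V E S. c u = c v}"
    using finite_proper_maps[OF assms(1,2)]
    by (subst card_Un_disjoint[symmetric]) (auto intro: arg_cong[where f = card])
  ultimately show ?thesis by (simp add: proper_maps_insert)
qed

lemma mixed_numerator_in_central_cone:
  assumes "finite V" "V \<noteq> {}" "finite E" "E \<subseteq> V \<times> V"
  shows "numerator (card V + 1) (\<lambda>k. int (card (strict_maps V R k \<inter> proper_maps V E {..<k})))
    \<in> central_cone (card V + 1)"
  using assms(3,4)
proof (induction E arbitrary: R rule: finite_induct)
  case empty
  have "strict_maps V R k \<inter> proper_maps V {} {..<k} = strict_maps V R k" for k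
    by (auto simp: strict_maps_def proper_maps_def)
  then show ?case
    using strict_numerator_in_central_cone[OF assms(1,2), of R] by (simp add: strict_numerator_def)
next
  case (insert e E)
  obtain u v where e_eq: "e = (u, v)" by (cases e)
  then have ends: "u \<in> V" "v \<in> V" using insert.prems by auto
  define M where "M R E k = strict_maps V R k \<inter> proper_maps V E {..<k}" for R E k
  have "M R (insert e E) k = M (insert (u, v) R) E k \<union> M (insert (v, u) R) E k" for k
    using ends by (auto simp: M_def e_eq strict_maps_insert proper_maps_insert)
  moreover have "M (insert (u, v) R) E k \<inter> M (insert (v, u) R) E k = {}" for k
    using ends by (auto simp: M_def strict_maps_insert)
  ultimately have "int (card (M R (insert e E) k)) =
      int (card (M (insert (u, v) R) E k)) + int (card (M (insert (v, u) R) E k))" for k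
    using finite_strict_maps[OF assms(1)] by (simp add: card_Un_disjoint M_def)
  then show ?case
    using insert.IH insert.prems by (simp add: numerator_add central_cone.add flip: M_def)
qed

lemma proper_numerator_in_central_cone:
  assumes "finite V" "V \<noteq> {}" "finite E" "E \<subseteq> V \<times> V"
  shows "numerator (card V + 1) (\<lambda>k. int (card (proper_maps V E {..<k})))
    \<in> central_cone (card V + 1)"
proof -
  have "strict_maps V {} k \<inter> proper_maps V E {..<k} = proper_maps V E {..<k}" for k
    by (auto simp: strict_maps_def proper_maps_def)
  then show ?thesis using mixed_numerator_in_central_cone[OF assms, of "{}"] by simp
qed

lemma improper_numerator_in_central_cone:
  assumes "finite V" "finite E" "E \<subseteq> V \<times> V" "irrefl E"
  shows "numerator (card V) (\<lambda>k. int k ^ card V - int (card (proper_maps V E {..<k})))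
    \<in> central_cone (card V)"
  using assms(2-4)
proof (induction E rule: finite_induct)
  case empty
  then show ?case
    using assms(1) by (simp add: card_proper_maps_no_arcs central_cone.zero)
next
  case (insert e E)
  obtain u v where e_eq: "e = (u, v)" by (cases e)
  have ends: "u \<in> V" "v \<in> V" "u \<noteq> v" using insert.prems e_eq by (auto simp: irrefl_def)
  have "E \<subseteq> V \<times> V" "irrefl E" using insert.prems by (auto simp: irrefl_def)
  have card_V: "card V = card (V - {v}) + 1" using card.remove[OF assms(1) ends(2)] by simp
  have split: "int k ^ card V - int (card (proper_maps V (insert e E) {..<k})) =
      (int k ^ card V - int (card (proper_maps V E {..<k}))) +
      int (card (proper_maps (V - {v}) (contract u v E) {..<k}))" for k
    using card_proper_maps_insert_contract[OF assms(1) finite_lessThan ends, of E k]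
    by (simp add: e_eq)
  have "numerator (card V) (\<lambda>k. int (card (proper_maps (V - {v}) (contract u v E) {..<k})))
      \<in> central_cone (card V)"
    unfolding card_V
    using assms(1) insert.hyps(1) ends contract_subset[OF ends(1,3) \<open>E \<subseteq> V \<times> V\<close>]
    by (intro proper_numerator_in_central_cone) (auto simp: contract_def)
  then show ?case
    unfolding split numerator_add
    using insert.IH[OF \<open>E \<subseteq> V \<times> V\<close> \<open>irrefl E\<close>] by (intro central_cone.add)
qed

lemma card_proper_maps_ge:
  assumes "finite V" "finite S" "finite E" "E \<subseteq> V \<times> V" "irrefl E"
  shows "card S ^ card V \<le> card (proper_maps V E S) + card E * card S ^ (card V - 1)"
  using assms(3-5)
proof (induction E rule: finite_induct)
  case empty
  then show ?case using assms(1) by (simp add: card_proper_maps_no_arcs)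
next
  case (insert e E)
  obtain u v where e_eq: "e = (u, v)" by (cases e)
  have ends: "u \<in> V" "v \<in> V" "u \<noteq> v" using insert.prems e_eq by (auto simp: irrefl_def)
  have "card (proper_maps (V - {v}) (contract u v E) S) \<le> card S ^ (card V - 1)"
    using card_proper_maps_le[of "V - {v}" S] assms(1,2) ends(2) by simp
  moreover have "card S ^ card V \<le> card (proper_maps V E S) + card E * card S ^ (card V - 1)"
    using insert.prems by (intro insert.IH) (auto simp: irrefl_def)
  ultimately show ?case
    using card_proper_maps_insert_contract[OF assms(1,2) ends, of E] insert.hyps
    by (simp add: e_eq)
qed

lemma card_le_if_card_proper_maps_eq:
  assumes "finite V" "finite E" "E \<subseteq> V \<times> V" "irrefl E" "finite W"
    and count_eq: "\<And>k. card (proper_maps V E {..<k}) = card (proper_maps W F {..<k :: nat})"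
  shows "card V \<le> card W"
proof (rule ccontr)
  assume "\<not> card V \<le> card W"
  then have less: "card W \<le> card V - 1" "card V = Suc (card V - 1)" by simp_all
  define k where "k = card E + 2"
  have "k * k ^ (card V - 1) = k ^ card V" by (subst less(2)) simp
  also have "\<dots> \<le> card (proper_maps W F {..<k}) + card E * k ^ (card V - 1)"
    using card_proper_maps_ge[of V "{..<k}" E] assms(1-4) count_eq by simp
  also have "card (proper_maps W F {..<k}) \<le> k ^ card W"
    using card_proper_maps_le[of W "{..<k}" F] assms(5) by simp
  also have "k ^ card W \<le> k ^ (card V - 1)"
    using less(1) by (intro power_increasing) (auto simp: k_def)
  finally show False by (simp add: k_def algebra_simps)
qed

lemma card_proper_maps_mono:
  assumes "finite V" "E \<subseteq> V \<times> V" "finite S" "finite T" "card S \<le> card T"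
  shows "card (proper_maps V E S) \<le> card (proper_maps V E T)"
proof -
  obtain f where range: "f ` S \<subseteq> T" and inj: "inj_on f S" using card_le_inj[OF assms(3-5)] by blast
  let ?recolour = "\<lambda>c. restrict (\<lambda>x. f (c x)) V"
  have "inj_on ?recolour (proper_maps V E S)"
  proof (rule inj_onI)
    fix c d assume maps: "c \<in> proper_maps V E S" "d \<in> proper_maps V E S"
      and recolour_eq: "?recolour c = ?recolour d"
    have "c x = d x" if "x \<in> V" for x
      using fun_cong[OF recolour_eq, of x] that maps inj
      by (auto simp: proper_maps_def dest: inj_onD)
    then show "c = d" using maps by (auto simp: proper_maps_def intro: PiE_ext)
  qed
  moreover have "?recolour ` proper_maps V E S \<subseteq> proper_maps V E T"
  proof (rule image_subsetI)
    fix c assume proper: "c \<in> proper_maps V E S"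
    have "f (c x) \<noteq> f (c y)" if "(x, y) \<in> E" for x y
    proof -
      have "c x \<in> S" "c y \<in> S" "c x \<noteq> c y"
        using that proper assms(2) by (auto simp: proper_maps_def)
      then show ?thesis using inj by (auto dest: inj_onD)
    qed
    moreover have "f (c x) \<in> T" if "x \<in> V" for x
      using proper range that by (auto simp: proper_maps_def PiE_iff)
    ultimately show "?recolour c \<in> proper_maps V E T"
      using assms(2) by (auto simp: proper_maps_def)
  qed
  ultimately show ?thesis
    using finite_proper_maps[OF assms(1,4)] by (rule card_inj_on_le)
qed

lemma card_proper_maps_value_at_apex:
  assumes "v \<in> V" "E \<subseteq> V \<times> V" "irrefl E" and apex: "\<And>x. x \<in> V - {v} \<Longrightarrow> (v, x) \<in> E"
    and "s \<in> S"
  defines "U \<equiv> V - {v}"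
  shows "card {c \<in> proper_maps V E S. c v = s} = card (proper_maps U (E \<inter> U \<times> U) (S - {s}))"
proof -
  define P where "P c \<longleftrightarrow> (\<forall>(x, y)\<in>E. c x \<noteq> c y)" for c :: "'a \<Rightarrow> 'b"
  have "{c \<in> proper_maps V E S. c v = s} = {c \<in> V \<rightarrow>\<^sub>E S. c v = s \<and> P c}"
    by (auto simp: proper_maps_def P_def)
  also have "card \<dots> = card {c \<in> U \<rightarrow>\<^sub>E S. P (c(v := s))}"
    unfolding U_def using assms(1,5) by (intro card_PiE_determined_value) auto
  also have "{c \<in> U \<rightarrow>\<^sub>E S. P (c(v := s))} = proper_maps U (E \<inter> U \<times> U) (S - {s})"
  proof (intro set_eqI iffI)
    fix c assume extended: "c \<in> {c \<in> U \<rightarrow>\<^sub>E S. P (c(v := s))}"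
    then have "c x \<noteq> s" if "x \<in> U" for x using apex[of x] that by (auto simp: P_def U_def)
    then show "c \<in> proper_maps U (E \<inter> U \<times> U) (S - {s})"
      using extended by (auto simp: proper_maps_def P_def U_def PiE_iff)
  next
    fix c assume proper: "c \<in> proper_maps U (E \<inter> U \<times> U) (S - {s})"
    have "(c(v := s)) x \<noteq> (c(v := s)) y" if "(x, y) \<in> E" for x y
    proof -
      have "x \<in> V" "y \<in> V" "x \<noteq> y" using that assms(2,3) by (auto simp: irrefl_def)
      then show ?thesis using proper that by (auto simp: proper_maps_def U_def PiE_iff)
    qed
    then have "P (c(v := s))" unfolding P_def by blast
    then show "c \<in> {c \<in> U \<rightarrow>\<^sub>E S. P (c(v := s))}"
      using proper by (auto simp: proper_maps_def PiE_iff)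
  qed
  finally show ?thesis .
qed

lemma card_proper_maps_cone:
  assumes "finite V" "finite S" "v \<in> V" "E \<subseteq> V \<times> V" "irrefl E"
    and apex: "\<And>x. x \<in> V - {v} \<Longrightarrow> (v, x) \<in> E"
  defines "U \<equiv> V - {v}"
  shows "card (proper_maps V E S) = card S * card (proper_maps U (E \<inter> U \<times> U) {..<card S - 1})"
proof -
  have "card (proper_maps V E S) = (\<Sum>s\<in>S. card {c \<in> proper_maps V E S. c v = s})"
    using assms(1-3)
    by (intro card_eq_sum_fibres finite_proper_maps) (auto simp: proper_maps_def)
  also have "\<dots> = (\<Sum>s\<in>S. card (proper_maps U (E \<inter> U \<times> U) {..<card S - 1}))"
  proof (rule sum.cong)
    fix s assume "s \<in> S"
    then have "card {c \<in> proper_maps V E S. c v = s} =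
        card (proper_maps U (E \<inter> U \<times> U) (S - {s}))"
      unfolding U_def using assms(3-5) apex by (intro card_proper_maps_value_at_apex)
    also have "\<dots> = card (proper_maps U (E \<inter> U \<times> U) {..<card S - 1})"
      using assms(1,2) \<open>s \<in> S\<close>
      by (intro order_antisym card_proper_maps_mono) (auto simp: U_def)
    finally show "card {c \<in> proper_maps V E S. c v = s} =
        card (proper_maps U (E \<inter> U \<times> U) {..<card S - 1})" .
  qed simp
  finally show ?thesis by simp
qed

section \<open>The h-vector as an Eulerian polynomial plus a central part\<close>

definition h_series :: "'a set \<Rightarrow> 'a rel \<Rightarrow> int fps" where
  "h_series V E =
     numerator (card V) (\<lambda>j. int (Suc j) ^ card V - int (card (proper_maps V E {..<j})))"

lemma h_series_eq_eulerian_plus_improper: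
  assumes "0 < card V"
  shows "h_series V E = eulerian_series (card V) +
    numerator (card V) (\<lambda>j. int j ^ card V - int (card (proper_maps V E {..<j})))"
proof -
  define m where "m = card V"
  have shift: "numerator m (\<lambda>j. int j ^ m) = fps_X * numerator m (\<lambda>j. int (Suc j) ^ m)"
    using assms by (intro numerator_Suc_shift) (simp add: m_def)
  have "eulerian_series m = (1 - fps_X) * numerator m (\<lambda>j. int (Suc j) ^ m)"
    by (simp only: numerator_Suc flip: numerator_power)
  also have "\<dots> = numerator m (\<lambda>j. int (Suc j) ^ m) - numerator m (\<lambda>j. int j ^ m)"
    unfolding shift by (simp only: left_diff_distrib mult_1_left)
  finally have eulerian_eq: "eulerian_series m =
    numerator m (\<lambda>j. int (Suc j) ^ m) - numerator m (\<lambda>j. int j ^ m)" .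
  show ?thesis unfolding h_series_def numerator_diff m_def[symmetric] eulerian_eq by simp
qed

lemma one_minus_fps_X_mult_h_series:
  "(1 - fps_X) * h_series V E =
    eulerian_series (card V) - numerator (card V + 1) (\<lambda>k. int (card (proper_maps V E {..<k})))"
  by (simp only: h_series_def numerator_diff right_diff_distrib numerator_Suc[symmetric]
      numerator_power Suc_eq_plus1[symmetric])

context
  fixes V :: "'a set" and E :: "'a rel"
  assumes verts: "finite V" "V \<noteq> {}" and arcs: "finite E" "E \<subseteq> V \<times> V" "irrefl E"
begin

lemma h_series_nth_le:
  assumes "i \<le> j" "i + j \<le> card V"
  shows "int (eulerian (card V) j) - int (eulerian (card V) i)
    \<le> h_series V E $ j - h_series V E $ i"
  using central_cone_nth_le[OF improper_numerator_in_central_cone[OF verts(1) arcs] assms] verts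
  by (simp add: h_series_eq_eulerian_plus_improper card_gt_0_iff)

lemma h_series_nth_Suc_le:
  assumes "2 * Suc i \<le> card V"
  shows "h_series V E $ i \<le> h_series V E $ Suc i"
  using h_series_nth_le[of i "Suc i"] eulerian_mono[OF assms] assms by simp

lemma h_series_nth_le_reflection:
  assumes "card V = Suc (i + j)" "i \<le> j"
  shows "h_series V E $ i \<le> h_series V E $ j"
  using h_series_nth_le[of i j] eulerian_symmetric[OF assms(1)] assms by simp

lemma h_series_difference_le: "((1 - fps_X) * h_series V E) $ i \<le> int (eulerian (card V) i)"
  unfolding one_minus_fps_X_mult_h_series
  using central_cone_nth_nonneg[OF proper_numerator_in_central_cone[OF verts arcs(1,2)]] by simp

lemma eulerian_diff_le_h_series_difference:
  assumes "2 * i \<le> card V"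
  shows "eulerian_diff (card V) i \<le> ((1 - fps_X) * h_series V E) $ i"
proof (cases i)
  case 0
  have "0 \<le> numerator (card V) (\<lambda>j. int j ^ card V - int (card (proper_maps V E {..<j}))) $ 0"
    using improper_numerator_in_central_cone[OF verts(1) arcs] by (rule central_cone_nth_nonneg)
  then show ?thesis
    using 0 verts
    by (simp add: one_minus_fps_X_mult_nth h_series_eq_eulerian_plus_improper card_gt_0_iff)
next
  case (Suc l)
  then show ?thesis
    using h_series_nth_le[of l i] assms by (simp add: one_minus_fps_X_mult_nth eulerian_diff_def)
qed

lemma M_vector_h_series_difference:
  "M_vector TYPE('k::field) (card V div 2) (\<lambda>i. of_int (((1 - fps_X) * h_series V E) $ i))"
proof -
  define g where "g i = nat (((1 - fps_X) * h_series V E) $ i)" for i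
  have lower: "eulerian_diff (card V) i \<le> ((1 - fps_X) * h_series V E) $ i"
    if "i \<le> card V div 2" for i
    using that by (intro eulerian_diff_le_h_series_difference) simp
  have int_g: "int (g i) = ((1 - fps_X) * h_series V E) $ i" if "i \<le> card V div 2" for i
  proof -
    have "0 \<le> eulerian_diff (card V) i" using that by (intro eulerian_diff_nonneg) simp
    then show ?thesis using lower[OF that] by (simp add: g_def)
  qed
  have "M_vector TYPE('k) (card V div 2) (\<lambda>i. of_nat (g i))"
  proof (rule M_vector_if_monomial_growth)
    show "g 0 = 1"
      using lower[of 0] h_series_difference_le[of 0] by (simp add: g_def)
    fix i assume "i < card V div 2"
    have "monomial_growth i (nat (eulerian_diff (card V) i)) (eulerian (card V) (Suc i))"
      using \<open>i < card V div 2\<close> by (intro monomial_growth_eulerian) simp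
    then show "monomial_growth i (g i) (g (Suc i))"
      using lower[of i] h_series_difference_le[of "Suc i"] \<open>i < card V div 2\<close>
      by (elim monomial_growth_mono) (auto simp: g_def nat_mono nat_le_iff)
  qed
  then show ?thesis
    by (rule M_vector_cong[THEN iffD1, rotated]) (simp flip: int_g)
qed

end

section \<open>Graphs with a vertex adjacent to all others\<close>

lemma proper_colourings_eq: "proper_colourings G k = proper_maps (pverts G) (parcs G) {..<k}"
  by (simp add: proper_colourings_def proper_maps_def)

lemma pair_graph_arcs:
  assumes "pair_graph G"
  shows "finite (pverts G)" "finite (parcs G)" "parcs G \<subseteq> pverts G \<times> pverts G" "irrefl (parcs G)"
proof -
  interpret pair_graph G by fact
  show "finite (pverts G)" "finite (parcs G)" by (rule pair_finite_verts pair_finite_arcs)+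
  show "parcs G \<subseteq> pverts G \<times> pverts G" using arc_fst_in_verts arc_snd_in_verts by fastforce
  show "irrefl (parcs G)" using pair_no_loops by (fastforce simp: irrefl_def)
qed

lemma poly_chromatic_polynomial_eq_card_proper_maps:
  assumes "pair_graph G"
  shows "poly (chromatic_polynomial G) (int k) =
    int (card (proper_maps (pverts G) (parcs G) {..<k}))"
  using poly_chromatic_polynomial[OF assms] by (simp add: proper_colourings_eq)

lemma card_pverts_le_if_chromatic_polynomial_eq:
  assumes "pair_graph G" "pair_graph H" "chromatic_polynomial G = chromatic_polynomial H"
  shows "card (pverts G) \<le> card (pverts H)"
proof (rule card_le_if_card_proper_maps_eq)
  show "card (proper_maps (pverts G) (parcs G) {..<k}) =
      card (proper_maps (pverts H) (parcs H) {..<k})" for k :: nat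
    using poly_chromatic_polynomial_eq_card_proper_maps[OF assms(1), of k]
      poly_chromatic_polynomial_eq_card_proper_maps[OF assms(2), of k] assms(3) by simp
qed (use pair_graph_arcs assms(1,2) in auto)

lemma card_pverts_eq_if_chromatic_polynomial_eq:
  assumes "pair_graph G" "pair_graph H" "chromatic_polynomial G = chromatic_polynomial H"
  shows "card (pverts G) = card (pverts H)"
  using assms by (intro order_antisym card_pverts_le_if_chromatic_polynomial_eq) simp_all

lemma adjacent_to_all_if_out_degree:
  assumes "pair_graph H" "v \<in> pverts H" "out_degree (with_proj H) v = card (pverts H) - 1"
    and "x \<in> pverts H - {v}"
  shows "(v, x) \<in> parcs H"
proof -
  define N where "N = {x. (v, x) \<in> parcs H}"
  have "out_arcs (with_proj H) v = Pair v ` N" by (auto simp: out_arcs_def N_def)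
  then have "card N = card (pverts H - {v})"
    using assms(2,3) by (simp add: out_degree_def card_image inj_on_def)
  moreover have "N \<subseteq> pverts H - {v}"
    using pair_graph_arcs[OF assms(1)] by (auto simp: N_def irrefl_def)
  ultimately have "N = pverts H - {v}"
    using pair_graph_arcs(1)[OF assms(1)] by (intro card_subset_eq) auto
  then show ?thesis using assms(4) by (auto simp: N_def)
qed

definition arcs_avoiding :: "'a pair_pre_digraph \<Rightarrow> 'a \<Rightarrow> 'a rel" where
  "arcs_avoiding H v = parcs H \<inter> (pverts H - {v}) \<times> (pverts H - {v})"

lemma poly_chromatic_polynomial_cone:
  assumes "pair_graph H" "v \<in> pverts H" "out_degree (with_proj H) v = card (pverts H) - 1"
  shows "poly (chromatic_polynomial H) (int (Suc k)) =
    int (Suc k) * int (card (proper_maps (pverts H - {v}) (arcs_avoiding H v) {..<k}))"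
proof -
  have "card (proper_maps (pverts H) (parcs H) {..<Suc k}) =
      Suc k * card (proper_maps (pverts H - {v}) (arcs_avoiding H v) {..<k})"
    using card_proper_maps_cone[of "pverts H" "{..<Suc k}" v "parcs H"]
      pair_graph_arcs[OF assms(1)] adjacent_to_all_if_out_degree[OF assms] assms(2)
    by (simp add: arcs_avoiding_def)
  then show ?thesis
    by (simp only: poly_chromatic_polynomial_eq_card_proper_maps[OF assms(1)] of_nat_mult)
qed

lemma chromatic_quotient_cone:
  assumes "pair_graph H" "v \<in> pverts H" "out_degree (with_proj H) v = card (pverts H) - 1"
  shows "(of_nat (Suc j) ^ card (pverts H) - of_int (poly (chromatic_polynomial H) (int (Suc j))))
      / of_nat (Suc j) =
    (of_int (int (Suc j) ^ card (pverts H - {v}) -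
      int (card (proper_maps (pverts H - {v}) (arcs_avoiding H v) {..<j}))) :: 'a::field_char_0)"
proof -
  have "card (pverts H) = Suc (card (pverts H - {v}))"
    using assms(2) pair_graph_arcs(1)[OF assms(1)] by (rule card.remove[rotated])
  then have "of_nat (Suc j) ^ card (pverts H) -
        of_int (poly (chromatic_polynomial H) (int (Suc j))) =
      of_nat (Suc j) * (of_int (int (Suc j) ^ card (pverts H - {v}) -
        int (card (proper_maps (pverts H - {v}) (arcs_avoiding H v) {..<j}))) :: 'a)"
    by (simp only: poly_chromatic_polynomial_cone[OF assms] power_Suc right_diff_distrib of_int_diff
        of_int_mult of_int_power of_int_of_nat_eq)
  then show ?thesis by (simp only: nonzero_mult_div_cancel_left[OF of_nat_neq_0])
qed

lemma h_coefficient_eq_h_series_nth: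
  fixes h :: "nat \<Rightarrow> 'a::field_char_0"
  assumes "pair_graph H" "v \<in> pverts H" "out_degree (with_proj H) v = card (pverts H) - 1"
    and series: "(\<Sum>i = 0..d. fps_const (h i) * fps_X ^ i) =
      numerator (card (pverts H) - 1) (\<lambda>j. (of_nat (Suc j) ^ card (pverts H) -
        of_int (poly (chromatic_polynomial H) (int (Suc j)))) / of_nat (Suc j))"
    and "i \<le> d"
  shows "h i = of_int (h_series (pverts H - {v}) (arcs_avoiding H v) $ i)"
proof -
  have "h i = (\<Sum>i = 0..d. fps_const (h i) * fps_X ^ i) $ i"
    using \<open>i \<le> d\<close> by (simp add: fps_sum_nth if_distrib cong: if_cong)
  also have "\<dots> = of_int (h_series (pverts H - {v}) (arcs_avoiding H v) $ i)"
    using assms(2) unfolding series chromatic_quotient_cone[OF assms(1-3)] h_series_def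
    by (simp only: of_int_numerator_nth card_Diff_singleton)
  finally show ?thesis .
qed

lemma nat_floor_half: "nat \<lfloor>real m / 2\<rfloor> = m div 2"
  by (metis floor_divide_of_nat_eq nat_int of_nat_numeral)

lemma nat_ceiling_half: "nat \<lceil>real m / 2\<rceil> = Suc m div 2"
  by linarith

theorem theorem5p7:
  fixes G :: "'a pair_pre_digraph" and H :: "'b pair_pre_digraph"
    and n :: nat and h :: "nat \<Rightarrow> rat"
  assumes "pair_graph G" and "card (pverts G) = n" and "n \<ge> 2"
    and "pair_graph H"
    and "chromatic_polynomial G = chromatic_polynomial H"
    and "\<exists>v \<in> pverts H. out_degree (with_proj H) v = n - 1"
    and "(\<Sum>i = 0..n - 2. fps_const (h i) * fps_X ^ i) =
      (1 - fps_X) ^ (n - 1) *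
      Abs_fps (\<lambda>j. (of_nat (j + 1) ^ n - of_int (poly (chromatic_polynomial G) (int (j + 1))))
                     / of_nat (j + 1))"
  shows "(\<forall>i < nat \<lfloor>real (n - 2) / 2\<rfloor>. h i \<le> h (i + 1)) \<and>
    (\<forall>i. real i \<le> real (n - 2) / 2 \<longrightarrow> h i \<le> h (n - 2 - i)) \<and>
    M_vector TYPE('k::field) (nat \<lceil>real (n - 2) / 2\<rceil>)
      (\<lambda>i. if i = 0 then h 0 else h i - h (i - 1))"
proof -
  obtain v where apex: "v \<in> pverts H" "out_degree (with_proj H) v = n - 1" using assms(6) by blast
  define U F where "U = pverts H - {v}" and "F = arcs_avoiding H v"
  have card_H: "card (pverts H) = n"
    using card_pverts_eq_if_chromatic_polynomial_eq[OF assms(1,4,5)] assms(2) by simp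
  then have card_U: "card U = Suc (n - 2)" using apex(1) assms(3) by (simp add: U_def)
  then have verts: "finite U" "U \<noteq> {}" by (auto intro: card_ge_0_finite)
  have arcs: "finite F" "F \<subseteq> U \<times> U" "irrefl F"
    using pair_graph_arcs[OF assms(4)] by (auto simp: U_def F_def arcs_avoiding_def irrefl_def)
  have h_eq: "h i = of_int (h_series U F $ i)" if "i \<le> n - 2" for i
    unfolding U_def F_def using assms(4,5,7) apex that
    by (intro h_coefficient_eq_h_series_nth) (simp_all add: card_H numerator_def)
  have "h i \<le> h (i + 1)" if "i < (n - 2) div 2" for i
    using that h_eq[of i] h_eq[of "i + 1"] h_series_nth_Suc_le[OF verts arcs, of i] card_U by simp
  moreover have "h i \<le> h (n - 2 - i)" if "real i \<le> real (n - 2) / 2" for i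
    using that h_eq[of i] h_eq[of "n - 2 - i"]
      h_series_nth_le_reflection[OF verts arcs, of i "n - 2 - i"]
      card_U assms(3) by simp
  moreover have "M_vector TYPE('k) (card U div 2) (\<lambda>i. if i = 0 then h 0 else h i - h (i - 1))"
  proof (rule M_vector_cong[THEN iffD1, OF _ M_vector_h_series_difference[OF verts arcs]])
    show "of_int (((1 - fps_X) * h_series U F) $ i) = (if i = 0 then h 0 else h i - h (i - 1))"
      if "i \<le> card U div 2" for i
      using that card_U assms(3) by (auto simp: one_minus_fps_X_mult_nth h_eq)
  qed
  ultimately show ?thesis unfolding nat_floor_half nat_ceiling_half card_U[symmetric] by blast
qed

end
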